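(* Let $(Q,U)$ be an object of $\mathfrak{C}_J$, and denote by $x_k$, $T_m$, $V$ also the images in $Q$ of the generators of the universal object $\widetilde{\mathrm{QISO}}^+_J(D_F)$ of $\mathfrak{C}_J$. Then $Q$ is an object in $\mathfrak{C}_{J,\mathbb{R}}$ if and only if the generators satisfy $$(T_m)_{jk}(T_m)_{j'k'}^*(T_m)_{j''k''}=(T_m)_{j''k''}(T_m)_{j'k'}^*(T_m)_{jk}$$ for all $m=1,\ldots,n$ and all $j,j',j'',k,k',k''\in\{1,2,3\}$.
   Context: Notation: for a matrix $u$ over a $*$-algebra, $(u^* )_{ij}=(u_{ji})^*$, $\bar u=(u^* )^t$; $(T_m)_{jk}^*=((T_m)_{jk})^*$. A biunitary is a matrix $u$ with $u,u^t$ unitary. $e_{ij}$ are matrix units. Finite triple. Fix $n\ge 3$. $H_F=\mathbb{C}^2\otimes\mathbb{C}^4\otimes\mathbb{C}^4\otimes\mathbb{C}^n$, $\mathcal{B}(H_F)=M_2(\mathbb{C})\otimes M_4(\mathbb{C})\otimes M_4(\mathbb{C})\otimes M_n(\mathbb{C})$. $J_F$ is the composition of componentwise complex conjugation with $1\otimes 1\otimes(e_{13}+e_{31}+e_{24}+e_{42})\otimes 1$, and $\gamma_F=1\otimes 1\otimes\mathrm{diag}(1,1,-1,-1)\otimes 1$. For $X,R\in M_n(\mathbb{C})$ let $$\mathcal{D}(X,R)=\begin{pmatrix} 0 & 0 & 0 & X \\ 0 & 0 & X^t & R \\ 0 & \bar X & 0 & 0 \\ X^* & R^* & 0 & 0 \end{pmatrix}\in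 M_4(\mathbb{C})\otimes M_n(\mathbb{C})$$ (blocks). Then $$D_F=e_{11}\otimes e_{11}\otimes\mathcal{D}(\Upsilon_\nu,\Upsilon_R)+e_{11}\otimes(1-e_{11})\otimes\mathcal{D}(\Upsilon_u,0)+e_{22}\otimes e_{11}\otimes\mathcal{D}(\Upsilon_e,0)+e_{22}\otimes(1-e_{11})\otimes\mathcal{D}(\Upsilon_d,0).$$ Assumptions: $\Upsilon_u,\Upsilon_e$ positive and diagonal; $\Upsilon_d,\Upsilon_\nu$ positive (semidefinite), $\Upsilon_d=C\delta_\downarrow C^*$ with $C\in SU(n)$, $\delta_\downarrow$ diagonal; $\Upsilon_R$ symmetric; the eigenvalues of $\Upsilon_e,\Upsilon_u,\Upsilon_d$ are non-zero and of multiplicity one; for $x\ne y$ in $\{\nu,e,u,d\}$, $\Upsilon_x$ and $\Upsilon_y$ have no common eigenvalue. $B_F\simeq\mathbb{C}\oplus\mathbb{C}\oplus M_2(\mathbb{C})\oplus M_3(\mathbb{C})$ consists of the operators $$\langle\lambda,\lambda',q,m\rangle=q\otimes1\otimes e_{11}\otimes1+\mathrm{diag}(\lambda,\lambda')\otimes1\otimes e_{44}\otimes1+1\otimes\begin{pmatrix}\lambda&0\\0&m\end{pmatrix}\otimes(e_{22}+e_{33})\otimes1.$$ Real algebra. $A_F=\mathbb{C}\oplus\mathbb{H}\oplus M_3(\mathbb{C})$ (real $C^*$-algebra, $\mathbb{H}$ the quaternions, viewed as matrices $\begin{pmatrix}\alpha&\beta\\-\bar\beta&\bar\alpha\end{pmatrix}$),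 with complexification $(A_F)_{\mathbb{C}}=A_F\otimes_{\mathbb{R}}\mathbb{C}\simeq\mathbb{C}\oplus\mathbb{C}\oplus M_2(\mathbb{C})\oplus M_3(\mathbb{C})\oplus M_3(\mathbb{C})$ (via $m\otimes_{\mathbb{R}}z\mapsto(mz,\bar mz)$ on the summands $M_k(\mathbb{C})$), in which $B_F$ is the subalgebra of elements $(\lambda,\lambda',q,m,0)$. $\sigma(a\otimes_{\mathbb{R}}z)=a\otimes_{\mathbb{R}}\bar z$; explicitly $\sigma(\lambda,\lambda',q,m,m')=(\bar\lambda',\bar\lambda,\sigma_2\bar q\sigma_2,\bar m',\bar m)$ with $\sigma_2=\begin{pmatrix} 0 & -i \\ i & 0 \end{pmatrix}$. Categories. A compact quantum group (CQG) is a unital $C^*$-algebra $Q$ with coassociative coproduct $\Delta$ satisfying Woronowicz's density conditions; a unitary corepresentation on finite-dimensional $H$ is a unitary $U\in\mathcal{B}(H)\otimes Q$ with $(id\otimes\Delta)U=U_{(12)}U_{(13)}$. A coaction of $Q$ on a unital $C^*$-algebra $\mathcal{A}$ is a unital $*$-homomorphism $\alpha:\mathcal{A}\to\mathcal{A}\otimes Q$ with $(\alpha\otimes id)\alpha=(id\otimes\Delta)\alpha$ and $\mathrm{Span}\{\alpha(a)(1\otimes b)\}$ dense in $\mathcal{A}\otimes Q$. Objects of $\mathfrak{C}_J$: pairs $(Q,U)$, $U$ a unitary corepresentation on $H_F$ commuting with $D_F\otimes1$, $\gamma_F\otimes1$, with $(J_F\otimes* )U(\xi\otimes1_Q)=U(J_F\xi\otimes1_Q)$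 for all $\xi\in H_F$ and $\mathrm{Ad}_U(B_F)\subset B_F\otimes_{\mathrm{alg}}Q$, $\mathrm{Ad}_U(a)=U(a\otimes1)U^*$; morphisms: CQG morphisms intertwining corepresentations. $\mathfrak{C}_{J,\mathbb{R}}$ is the subcategory (same morphisms) of those objects for which $\mathrm{Ad}_U$ can be extended to a coaction $\alpha$ on $(A_F)_{\mathbb{C}}$ satisfying $(\sigma\otimes* )\alpha=\alpha\sigma$. Universal object of $\mathfrak{C}_J$: $\widetilde{\mathrm{QISO}}^+_J(D_F)$ is the universal $C^*$-algebra generated by unitaries $x_0,\dots,x_n$, the entries of $3\times3$ biunitaries $T_1,\dots,T_n$ and of an $n\times n$ biunitary $V$, with relations $\mathrm{diag}(x_0x_k)\Upsilon_\nu=\Upsilon_\nu\mathrm{diag}(x_0x_k)=\bar V\Upsilon_\nu=\Upsilon_\nu\bar V$, $V\Upsilon_R=\Upsilon_R\bar V$, $\sum_m\bar C_{mr}C_{ms}(T_m)_{jk}=0$ ($r\ne s$), $(T_m^* )_{ij}(T_m)_{kl}=(T_{m'}^* )_{ij}(T_{m'})_{kl}$, with matrix coproduct. Its corepresentation is $U=u\oplus\bar u$ in the sense that $U=\sum e_{aa'}\otimes e_{bb'}\otimes e_{cc'}\otimes e_{dd'}\otimes u_{\cdot}+\sum e_{aa'}\otimes e_{bb'}\otimes e_{c+2,c'+2}\otimes e_{dd'}\otimes u_{\cdot}^*$ ($c,c'\in\{1,2\}$), where the first sum is $e_{11}\otimes e_{11}\otimes e_{11}\otimes\sum_ke_{kk}\otimes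 x_0x_k+e_{11}\otimes e_{11}\otimes e_{22}\otimes\sum_{jk}e_{jk}\otimes V_{jk}+e_{22}\otimes e_{11}\otimes\sum_k(e_{11}\otimes e_{kk}\otimes x_k+e_{22}\otimes e_{kk}\otimes x_k^* )+e_{11}\otimes\sum_{j,k,m}e_{j+1,k+1}\otimes(e_{11}\otimes e_{mm}\otimes(T_m)_{jk}+e_{22}\otimes e_{mm}\otimes(T_m)_{jk}^* )+e_{22}\otimes\sum_{j,k,m}e_{j+1,k+1}\otimes(e_{11}\otimes e_{mm}\otimes x_0^*(T_m)_{jk}+e_{22}\otimes e_{mm}\otimes(T_m)_{jk}^*x_0)$. The adjoint coaction fixes $\langle1,0,0,0\rangle$, $\langle0,1,0,0\rangle$, $\langle0,0,e_{ii},0\rangle$, sends $\langle0,0,e_{12},0\rangle\mapsto\langle0,0,e_{12},0\rangle\otimes x_0$, $\langle0,0,e_{21},0\rangle\mapsto\langle0,0,e_{21},0\rangle\otimes x_0^*$ and $\langle0,0,0,e_{ij}\rangle\mapsto\sum_{k,l}\langle0,0,0,e_{kl}\rangle\otimes(T_1)_{ki}^*(T_1)_{lj}$. *)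

theory Defs
  imports "HOL-Analysis.Analysis" "HOL-Library.Poly_Mapping"
begin

section \<open>Complex *-algebras and C*-algebras\<close>

class star =
  fixes star :: "'a \<Rightarrow> 'a"

class star_algebra = ring_1 + star +
  fixes scaleC :: "complex \<Rightarrow> 'a \<Rightarrow> 'a"
  assumes scaleC_add_right: "scaleC c (x + y) = scaleC c x + scaleC c y"
    and scaleC_add_left: "scaleC (c + d) x = scaleC c x + scaleC d x"
    and scaleC_scaleC: "scaleC c (scaleC d x) = scaleC (c * d) x"
    and scaleC_one: "scaleC 1 x = x"
    and mult_scaleC_left: "scaleC c x * y = scaleC c (x * y)"
    and mult_scaleC_right: "x * scaleC c y = scaleC c (x * y)"
    and star_add: "star (x + y) = star x + star y"
    and star_mult: "star (x * y) = star y * star x"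
    and star_star: "star (star x) = x"
    and star_scaleC: "star (scaleC c x) = scaleC (cnj c) (star x)"
begin

lemma scaleC_zero_right: "scaleC c 0 = 0"
  using scaleC_add_right[of c 0 0] by simp

lemma scaleC_zero_left: "scaleC 0 x = 0"
  using scaleC_add_left[of 0 0 x] by simp

lemma star_zero: "star 0 = 0"
  using star_add[of 0 0] by simp

end

text \<open>Unital, non-zero C*-algebras.\<close>

class cstar_algebra = star_algebra + real_normed_algebra_1 + complete_space +
  assumes scaleR_eq_scaleC: "scaleR r x = scaleC (complex_of_real r) x"
    and norm_scaleC: "norm (scaleC c x) = cmod c * norm x"
    and cstar_identity: "norm (star x * x) = (norm x)\<^sup>2"

instantiation complex :: cstar_algebra
begin

definition star_complex :: "complex \<Rightarrow> complex" where
  "star_complex = cnj"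

definition scaleC_complex :: "complex \<Rightarrow> complex \<Rightarrow> complex" where
  "scaleC_complex = (*)"

instance
  by standard (auto simp: star_complex_def scaleC_complex_def algebra_simps scaleR_conv_of_real
      norm_mult power2_eq_square)

end

definition star_hom :: "('a::star_algebra \<Rightarrow> 'b::star_algebra) \<Rightarrow> bool" where
  "star_hom f \<longleftrightarrow>
     (\<forall>x y. f (x + y) = f x + f y) \<and> (\<forall>c x. f (scaleC c x) = scaleC c (f x)) \<and>
     (\<forall>x y. f (x * y) = f x * f y) \<and> f 1 = 1 \<and> (\<forall>x. f (star x) = star (f x))"

text \<open>C*-seminorms on a *-subalgebra \<open>S\<close>; non-negativity follows from the first two clauses.\<close>

definition cstar_seminorm_on :: "'a::star_algebra set \<Rightarrow> ('a \<Rightarrow> real) \<Rightarrow> bool" where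
  "cstar_seminorm_on S p \<longleftrightarrow>
     (\<forall>x\<in>S. \<forall>y\<in>S. p (x + y) \<le> p x + p y) \<and> (\<forall>c. \<forall>x\<in>S. p (scaleC c x) = cmod c * p x) \<and>
     (\<forall>x\<in>S. \<forall>y\<in>S. p (x * y) \<le> p x * p y) \<and> (\<forall>x\<in>S. p (star x * x) = (p x)\<^sup>2)"

definition cstar_norm_on :: "'a::star_algebra set \<Rightarrow> ('a \<Rightarrow> real) \<Rightarrow> bool" where
  "cstar_norm_on S p \<longleftrightarrow> cstar_seminorm_on S p \<and> (\<forall>x\<in>S. p x = 0 \<longrightarrow> x = 0)"


section \<open>Universal C*-algebras\<close>

text \<open>The free unital *-algebra on a set of generators is the algebra of finitely supported
  complex functions on words in the letters \<open>(s, False)\<close>, standing for \<open>s\<close>, and \<open>(s, True)\<close>,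
  standing for \<open>s\<^sup>*\<close>, with the convolution product of \<^theory>\<open>HOL-Library.Poly_Mapping\<close>.
  The latter writes the monoid of words additively.\<close>

datatype 'g word = Word (letters: "('g \<times> bool) list")

instantiation word :: (type) monoid_add
begin

definition zero_word :: "'a word" where
  "zero_word = Word []"

definition plus_word :: "'a word \<Rightarrow> 'a word \<Rightarrow> 'a word" where
  "plus_word v w = Word (letters v @ letters w)"

instance
  by standard (auto simp: zero_word_def plus_word_def)

end

class star_monoid_add = monoid_add + star +
  assumes star_plus: "star (x + y) = star y + star x"
    and star_star_monoid: "star (star x) = x"
begin

lemma star_zero_monoid: "star 0 = 0"
  by (metis add_0_right add_0_left star_plus star_star_monoid)

lemma inj_star: "inj star"
  by (metis injI star_star_monoid)

end

instantiation word :: (type) star_monoid_add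
begin

definition star_word :: "'a word \<Rightarrow> 'a word" where
  "star_word w = Word (rev (map (\<lambda>(s, b). (s, \<not> b)) (letters w)))"

instance
  by standard (auto simp: star_word_def plus_word_def rev_map split_def comp_def)

end

lemma poly_mapping_add_induct [case_names zero single add]:
  fixes p :: "'a \<Rightarrow>\<^sub>0 'b::comm_monoid_add"
  assumes "P 0" "\<And>k v. P (Poly_Mapping.single k v)" "\<And>p q. P p \<Longrightarrow> P q \<Longrightarrow> P (p + q)"
  shows "P p"
proof (induction p rule: update_induct)
  case const
  then show ?case using assms(1) .
next
  case (update f a b)
  have "Poly_Mapping.update a b f = f + Poly_Mapping.single a b"
    using update(1)
    by (intro poly_mapping_eqI) (auto simp: lookup_update lookup_add lookup_single when_def in_keys_iff)
  then show ?case using assms(2,3) update by metis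
qed

instantiation poly_mapping :: (star_monoid_add, star_algebra) star_algebra
begin

definition star_poly_mapping :: "('a \<Rightarrow>\<^sub>0 'b) \<Rightarrow> ('a \<Rightarrow>\<^sub>0 'b)" where
  "star_poly_mapping p = Poly_Mapping.map star (Poly_Mapping.map_key star p)"

definition scaleC_poly_mapping :: "complex \<Rightarrow> ('a \<Rightarrow>\<^sub>0 'b) \<Rightarrow> ('a \<Rightarrow>\<^sub>0 'b)" where
  "scaleC_poly_mapping c p = Poly_Mapping.map (scaleC c) p"

lemma lookup_star: "poly_mapping.lookup (star p) w = star (poly_mapping.lookup p (star w))"
  for p :: "'a \<Rightarrow>\<^sub>0 'b"
  by (auto simp: star_poly_mapping_def Poly_Mapping.map.rep_eq
      map_key.rep_eq[OF inj_star] when_def star_zero)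

lemma lookup_scaleC: "poly_mapping.lookup (scaleC c p) w = scaleC c (poly_mapping.lookup p w)"
  for p :: "'a \<Rightarrow>\<^sub>0 'b"
  by (auto simp: scaleC_poly_mapping_def Poly_Mapping.map.rep_eq when_def scaleC_zero_right)

lemma star_pm_add: "star (p + q) = star p + star q" for p q :: "'a \<Rightarrow>\<^sub>0 'b"
  by (rule poly_mapping_eqI) (simp add: lookup_star lookup_add star_add)

lemma scaleC_pm_add: "scaleC c (p + q) = scaleC c p + scaleC c q" for p q :: "'a \<Rightarrow>\<^sub>0 'b"
  by (rule poly_mapping_eqI) (simp add: lookup_scaleC lookup_add scaleC_add_right)

lemma star_pm_zero: "star 0 = (0 :: 'a \<Rightarrow>\<^sub>0 'b)"
  by (rule poly_mapping_eqI) (simp add: lookup_star star_zero)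

lemma scaleC_pm_zero: "scaleC c 0 = (0 :: 'a \<Rightarrow>\<^sub>0 'b)"
  by (rule poly_mapping_eqI) (simp add: lookup_scaleC scaleC_zero_right)

lemma star_single: "star (Poly_Mapping.single k v) = Poly_Mapping.single (star k) (star v)"
  for k :: 'a and v :: 'b
  by (rule poly_mapping_eqI)
    (auto simp: lookup_star lookup_single when_def star_zero star_star_monoid)

lemma scaleC_single: "scaleC c (Poly_Mapping.single k v) = Poly_Mapping.single k (scaleC c v)"
  for k :: 'a and v :: 'b
  by (rule poly_mapping_eqI) (auto simp: lookup_scaleC lookup_single when_def scaleC_zero_right)

instance
proof
  fix c d :: complex and x y :: "'a \<Rightarrow>\<^sub>0 'b"
  show "scaleC c (x + y) = scaleC c x + scaleC c y"
    by (rule scaleC_pm_add)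
  show "scaleC (c + d) x = scaleC c x + scaleC d x"
    by (rule poly_mapping_eqI) (simp add: lookup_scaleC lookup_add scaleC_add_left)
  show "scaleC c (scaleC d x) = scaleC (c * d) x"
    by (rule poly_mapping_eqI) (simp add: lookup_scaleC scaleC_scaleC)
  show "scaleC 1 x = x"
    by (rule poly_mapping_eqI) (simp add: lookup_scaleC scaleC_one)
  show "star (x + y) = star x + star y"
    by (rule star_pm_add)
  show "star (star x) = x"
    by (rule poly_mapping_eqI) (simp add: lookup_star star_star star_star_monoid)
  show "star (scaleC c x) = scaleC (cnj c) (star x)"
    by (rule poly_mapping_eqI) (simp add: lookup_star lookup_scaleC star_scaleC)
  have *: "scaleC c (Poly_Mapping.single k v) * y = scaleC c (Poly_Mapping.single k v * y)"
    "Poly_Mapping.single k v * scaleC c y = scaleC c (Poly_Mapping.single k v * y)"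
    "star (Poly_Mapping.single k v * y) = star y * star (Poly_Mapping.single k v)"
    for k :: 'a and v :: 'b and y
    by (induction y rule: poly_mapping_add_induct)
      (simp_all add: scaleC_pm_zero star_pm_zero scaleC_single star_single mult_single star_plus
        star_mult mult_scaleC_left mult_scaleC_right scaleC_pm_add star_pm_add distrib_left
        distrib_right)
  show "scaleC c x * y = scaleC c (x * y)"
    by (induction x rule: poly_mapping_add_induct)
      (simp_all add: * scaleC_pm_zero scaleC_pm_add distrib_right)
  show "x * scaleC c y = scaleC c (x * y)"
    by (induction x rule: poly_mapping_add_induct)
      (simp_all add: * scaleC_pm_zero scaleC_pm_add distrib_right)
  show "star (x * y) = star y * star x"
    by (induction x rule: poly_mapping_add_induct)
      (simp_all add: * star_pm_zero star_pm_add distrib_right distrib_left)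
qed

end

type_synonym 'g free = "'g word \<Rightarrow>\<^sub>0 complex"

definition free_gen :: "'g \<Rightarrow> 'g free" where
  "free_gen s = Poly_Mapping.single (Word [(s, False)]) 1"

text \<open>The ambient type, with the family \<open>g\<close>, is the universal C*-algebra on generators indexed by
  \<open>'g\<close> subject to \<open>r = 0\<close> for \<open>r \<in> R\<close>: the relations hold, the \<open>g s\<close> generate, and the norm is
  the largest C*-seminorm compatible with the relations.\<close>

definition universal_cstar_algebra :: "'g free set \<Rightarrow> ('g \<Rightarrow> 'a::cstar_algebra) \<Rightarrow> bool" where
  "universal_cstar_algebra R g \<longleftrightarrow>
     (\<exists>ev :: 'g free \<Rightarrow> 'a. star_hom ev \<and> (\<forall>s. ev (free_gen s) = g s) \<and> (\<forall>r\<in>R. ev r = 0) \<and>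
        closure (range ev) = UNIV \<and>
        (\<forall>p. cstar_seminorm_on UNIV p \<and> (\<forall>r\<in>R. p r = 0) \<longrightarrow> (\<forall>x. p x \<le> norm (ev x))))"


section \<open>Compact quantum groups\<close>

text \<open>\<open>t\<close> exhibits \<open>'c\<close> as the minimal C*-tensor product of \<open>'a\<close> and \<open>'b\<close>: the real span of the
  elementary tensors is the (complex) algebraic tensor product, it is dense, and the norm of \<open>'c\<close>
  restricted to it is its least C*-norm.\<close>

definition min_tensor ::
    "('a::cstar_algebra \<Rightarrow> 'b::cstar_algebra \<Rightarrow> 'c::cstar_algebra) \<Rightarrow> bool" where
  "min_tensor t \<longleftrightarrow>
     (\<forall>a a' b. t (a + a') b = t a b + t a' b) \<and> (\<forall>a b b'. t a (b + b') = t a b + t a b') \<and>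
     (\<forall>c a b. t (scaleC c a) b = scaleC c (t a b)) \<and>
     (\<forall>c a b. t a (scaleC c b) = scaleC c (t a b)) \<and>
     (\<forall>a a' b b'. t a b * t a' b' = t (a * a') (b * b')) \<and>
     (\<forall>a b. star (t a b) = t (star a) (star b)) \<and> t 1 1 = 1 \<and>
     (\<forall>(n::nat) a b. (\<forall>c. (\<Sum>i<n. scaleC (c i) (b i)) = 0 \<longrightarrow> (\<forall>i<n. c i = 0)) \<longrightarrow>
        (\<Sum>i<n. t (a i) (b i)) = 0 \<longrightarrow> (\<forall>i<n. a i = 0)) \<and>
     closure (span (range (case_prod t))) = UNIV \<and>
     (\<forall>p. cstar_norm_on (span (range (case_prod t))) p \<longrightarrow>
        (\<forall>x\<in>span (range (case_prod t)). norm x \<le> p x))"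

text \<open>\<open>h = f \<otimes> g\<close>, relative to the tensor products \<open>t\<close> and \<open>t'\<close>.  As C*-homomorphisms are
  continuous, \<open>h\<close> is unique when \<open>t\<close> is a minimal tensor product.\<close>

definition is_tensor_map ::
    "('a \<Rightarrow> 'b \<Rightarrow> 'c::cstar_algebra) \<Rightarrow> ('d \<Rightarrow> 'e \<Rightarrow> 'f::cstar_algebra) \<Rightarrow>
     ('a \<Rightarrow> 'd) \<Rightarrow> ('b \<Rightarrow> 'e) \<Rightarrow> ('c \<Rightarrow> 'f) \<Rightarrow> bool" where
  "is_tensor_map t t' f g h \<longleftrightarrow> star_hom h \<and> (\<forall>a b. h (t a b) = t' (f a) (g b))"

text \<open>Besides the coproduct, the record carries realisations \<open>'qq\<close> of \<open>Q \<otimes> Q\<close> and \<open>'qqq\<close> of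
  \<open>Q \<otimes> Q \<otimes> Q\<close>; the fields \<open>ten_l\<close> and \<open>ten_r\<close> are the two groupings of the latter.\<close>

record ('q, 'qq, 'qqq) cqg =
  ten :: "'q \<Rightarrow> 'q \<Rightarrow> 'qq"
  ten_l :: "'qq \<Rightarrow> 'q \<Rightarrow> 'qqq"
  ten_r :: "'q \<Rightarrow> 'qq \<Rightarrow> 'qqq"
  coprod :: "'q \<Rightarrow> 'qq"

definition compact_quantum_group ::
    "('q::cstar_algebra, 'qq::cstar_algebra, 'qqq::cstar_algebra) cqg \<Rightarrow> bool" where
  "compact_quantum_group Q \<longleftrightarrow>
     min_tensor (ten Q) \<and> min_tensor (ten_l Q) \<and> min_tensor (ten_r Q) \<and>
     (\<forall>a b c. ten_l Q (ten Q a b) c = ten_r Q a (ten Q b c)) \<and>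
     star_hom (coprod Q) \<and>
     (\<exists>F G. is_tensor_map (ten Q) (ten_l Q) (coprod Q) id F \<and>
        is_tensor_map (ten Q) (ten_r Q) id (coprod Q) G \<and>
        (\<forall>a. F (coprod Q a) = G (coprod Q a))) \<and>
     closure (span {coprod Q a * ten Q 1 b | a b. True}) = UNIV \<and>
     closure (span {coprod Q a * ten Q b 1 | a b. True}) = UNIV"

definition cqg_morphism ::
    "('p::cstar_algebra, 'pp::cstar_algebra, 'ppp::cstar_algebra) cqg \<Rightarrow>
     ('q::cstar_algebra, 'qq::cstar_algebra, 'qqq::cstar_algebra) cqg \<Rightarrow> ('p \<Rightarrow> 'q) \<Rightarrow> bool" where
  "cqg_morphism P Q f \<longleftrightarrow>
     star_hom f \<and>
     (\<exists>F. is_tensor_map (ten P) (ten Q) f f F \<and> (\<forall>a. coprod Q (f a) = F (coprod P a)))"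


section \<open>Matrices over *-algebras\<close>

text \<open>\<open>M_k(\<complex>) \<otimes> Q\<close> is the algebra of matrices over \<open>Q\<close>, and \<open>(id \<otimes> f)\<close> is \<^const>\<open>map_matrix\<close>.\<close>

definition bar :: "'a::star^'i^'j \<Rightarrow> 'a^'i^'j" where
  "bar u = map_matrix star u"

definition adj :: "'a::star^'i^'j \<Rightarrow> 'a^'j^'i" where
  "adj u = (\<chi> i j. star (u $ j $ i))"

definition unitary_mat :: "'a::star_algebra^'i^'i \<Rightarrow> bool" where
  "unitary_mat u \<longleftrightarrow> u ** adj u = mat 1 \<and> adj u ** u = mat 1"

definition unit_mat :: "'i \<Rightarrow> 'i \<Rightarrow> 'a::zero_neq_one^'i^'i" where
  "unit_mat i j = (\<chi> k l. if k = i \<and> l = j then 1 else 0)"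

definition diag_mat :: "('i \<Rightarrow> 'a::zero) \<Rightarrow> 'a^'i^'i" where
  "diag_mat f = (\<chi> i j. if i = j then f i else 0)"

definition kron :: "'a::times^'i^'i \<Rightarrow> 'a^'j^'j \<Rightarrow> 'a^('i \<times> 'j)^('i \<times> 'j)" where
  "kron A B = (\<chi> p q. A $ fst p $ fst q * B $ snd p $ snd q)"

definition kron4 ::
    "'a::times^'i^'i \<Rightarrow> 'a^'j^'j \<Rightarrow> 'a^'k^'k \<Rightarrow> 'a^'l^'l \<Rightarrow>
     'a^('i \<times> 'j \<times> 'k \<times> 'l)^('i \<times> 'j \<times> 'k \<times> 'l)" where
  "kron4 A B C D = kron A (kron B (kron C D))"

definition lift_mat :: "complex^'i^'j \<Rightarrow> 'a::star_algebra^'i^'j" where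
  "lift_mat A = map_matrix (\<lambda>c. scaleC c 1) A"

definition lift_vec :: "complex^'i \<Rightarrow> 'a::star_algebra^'i" where
  "lift_vec \<xi> = (\<chi> i. scaleC (\<xi> $ i) 1)"

text \<open>The corner \<open>diag(0, m)\<close> in \<open>M_4\<close>, i.e. \<open>\<Sum> m_{jk} e_{j+1,k+1}\<close>.  The elements of the index
  type \<open>4\<close> are \<open>1, 2, 3, 4\<close> with \<open>4 = 0\<close>, and those of \<open>3\<close> are \<open>1, 2, 3\<close>.\<close>

definition up :: "3 \<Rightarrow> 4" where
  "up j = (if j = 1 then 2 else if j = 2 then 3 else 4)"

definition corner :: "'a::comm_monoid_add^3^3 \<Rightarrow> 'a^4^4" where
  "corner m = (\<chi> a b. \<Sum>j\<in>UNIV. \<Sum>k\<in>UNIV. if a = up j \<and> b = up k then m $ j $ k else 0)"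


section \<open>The finite triple\<close>

type_synonym 'n hf = "2 \<times> 4 \<times> 4 \<times> 'n"

record 'n yukawa =
  Ynu :: "complex^'n^'n"
  Ye :: "complex^'n^'n"
  Yu :: "complex^'n^'n"
  Yd :: "complex^'n^'n"
  YR :: "complex^'n^'n"
  mixing :: "complex^'n^'n"
  delta :: "complex^'n^'n"

definition psd_mat :: "complex^'n^'n \<Rightarrow> bool" where
  "psd_mat A \<longleftrightarrow> (\<forall>v. (\<Sum>i\<in>UNIV. cnj (v $ i) * (A *v v) $ i) \<in> \<real>\<^sub>\<ge>\<^sub>0)"

definition diagonal_mat :: "complex^'n^'n \<Rightarrow> bool" where
  "diagonal_mat A \<longleftrightarrow> (\<forall>i j. i \<noteq> j \<longrightarrow> A $ i $ j = 0)"

definition eigenvalues :: "complex^'n^'n \<Rightarrow> complex set" where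
  "eigenvalues A = {c. \<exists>v. v \<noteq> 0 \<and> A *v v = c *s v}"

text \<open>Used only for positive, hence diagonalisable, matrices, so that the multiplicity of an
  eigenvalue is the dimension of its eigenspace.\<close>

definition simple_nonzero_spectrum :: "complex^'n^'n \<Rightarrow> bool" where
  "simple_nonzero_spectrum A \<longleftrightarrow>
     (\<forall>c\<in>eigenvalues A. c \<noteq> 0 \<and> vec.dim {v. A *v v = c *s v} = 1)"

definition yukawa_assumptions :: "'n::finite yukawa \<Rightarrow> bool" where
  "yukawa_assumptions Y \<longleftrightarrow>
     psd_mat (Yu Y) \<and> diagonal_mat (Yu Y) \<and> psd_mat (Ye Y) \<and> diagonal_mat (Ye Y) \<and>
     psd_mat (Yd Y) \<and> psd_mat (Ynu Y) \<and>
     unitary_mat (mixing Y) \<and> det (mixing Y) = 1 \<and> diagonal_mat (delta Y) \<and>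
     Yd Y = mixing Y ** delta Y ** adj (mixing Y) \<and>
     transpose (YR Y) = YR Y \<and>
     simple_nonzero_spectrum (Ye Y) \<and> simple_nonzero_spectrum (Yu Y) \<and>
     simple_nonzero_spectrum (Yd Y) \<and>
     eigenvalues (Ynu Y) \<inter> eigenvalues (Ye Y) = {} \<and>
     eigenvalues (Ynu Y) \<inter> eigenvalues (Yu Y) = {} \<and>
     eigenvalues (Ynu Y) \<inter> eigenvalues (Yd Y) = {} \<and>
     eigenvalues (Ye Y) \<inter> eigenvalues (Yu Y) = {} \<and>
     eigenvalues (Ye Y) \<inter> eigenvalues (Yd Y) = {} \<and>
     eigenvalues (Yu Y) \<inter> eigenvalues (Yd Y) = {}"

definition dirac_block :: "complex^'n^'n \<Rightarrow> complex^'n^'n \<Rightarrow> complex^(4 \<times> 'n)^(4 \<times> 'n)" where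
  "dirac_block X R =
     kron (unit_mat 1 4) X +
     kron (unit_mat 2 3) (transpose X) + kron (unit_mat 2 4) R +
     kron (unit_mat 3 2) (bar X) +
     kron (unit_mat 4 1) (adj X) + kron (unit_mat 4 2) (adj R)"

definition D_F :: "'n::finite yukawa \<Rightarrow> complex^('n hf)^('n hf)" where
  "D_F Y =
     kron (unit_mat 1 1) (kron (unit_mat 1 1) (dirac_block (Ynu Y) (YR Y))) +
     kron (unit_mat 1 1) (kron (mat 1 - unit_mat 1 1) (dirac_block (Yu Y) 0)) +
     kron (unit_mat 2 2) (kron (unit_mat 1 1) (dirac_block (Ye Y) 0)) +
     kron (unit_mat 2 2) (kron (mat 1 - unit_mat 1 1) (dirac_block (Yd Y) 0))"

definition gamma_F :: "complex^('n::finite hf)^('n hf)" where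
  "gamma_F =
     kron4 (mat 1) (mat 1) (diag_mat (\<lambda>c. if c = 1 \<or> c = 2 then 1 else - 1)) (mat 1)"

definition J_matrix :: "'a::ring_1^('n::finite hf)^('n hf)" where
  "J_matrix =
     kron4 (mat 1) (mat 1) (unit_mat 1 3 + unit_mat 3 1 + unit_mat 2 4 + unit_mat 4 2) (mat 1)"

text \<open>At \<open>'a = complex\<close> this is \<open>J_F\<close>; at \<open>'a = Q\<close> it is \<open>J_F \<otimes> *\<close> on \<open>H_F \<otimes> Q\<close>.\<close>

definition J_F :: "'a::star_algebra^('n::finite hf) \<Rightarrow> 'a^('n hf)" where
  "J_F \<xi> = J_matrix *v (\<chi> i. star (\<xi> $ i))"

text \<open>At \<open>'a = complex\<close> this is the operator \<open>\<langle>\<lambda>, \<lambda>', q, m\<rangle>\<close> and its range is \<open>B_F\<close>; at \<open>'a = Q\<close>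
  its range is the algebraic tensor product \<open>B_F \<otimes> Q\<close>.\<close>

fun bf_op ::
    "'a::ring_1 \<times> 'a \<times> ('a^2^2) \<times> ('a^3^3) \<Rightarrow> 'a^('n::finite hf)^('n hf)" where
  "bf_op (l, l', q, m) =
     kron4 q (mat 1) (unit_mat 1 1) (mat 1) +
     kron4 (diag_mat (\<lambda>a. if a = 1 then l else l')) (mat 1) (unit_mat 4 4) (mat 1) +
     kron4 (mat 1) (diag_mat (\<lambda>b. if b = 1 then l else 0) + corner m)
       (unit_mat 2 2 + unit_mat 3 3) (mat 1)"


section \<open>The category \<open>\<CC>_J\<close>\<close>

definition unitary_corep ::
    "('q::cstar_algebra, 'qq::cstar_algebra, 'qqq::cstar_algebra) cqg \<Rightarrow> 'q^'i^'i \<Rightarrow> bool" where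
  "unitary_corep Q U \<longleftrightarrow> unitary_mat U \<and>
     (\<forall>i j. coprod Q (U $ i $ j) = (\<Sum>k\<in>UNIV. ten Q (U $ i $ k) (U $ k $ j)))"

definition Ad :: "'q::star_algebra^'i^'i \<Rightarrow> complex^'i^'i \<Rightarrow> 'q^'i^'i" where
  "Ad U a = U ** lift_mat a ** adj U"

definition CJ_object ::
    "'n::finite yukawa \<Rightarrow> ('q::cstar_algebra, 'qq::cstar_algebra, 'qqq::cstar_algebra) cqg \<Rightarrow>
     'q^('n hf)^('n hf) \<Rightarrow> bool" where
  "CJ_object Y Q U \<longleftrightarrow>
     compact_quantum_group Q \<and> unitary_corep Q U \<and>
     U ** lift_mat (D_F Y) = lift_mat (D_F Y) ** U \<and>
     U ** lift_mat gamma_F = lift_mat gamma_F ** U \<and>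
     (\<forall>\<xi> :: complex^('n hf). J_F (U *v lift_vec \<xi>) = U *v lift_vec (J_F \<xi>)) \<and>
     (\<forall>b. Ad U (bf_op b) \<in> range bf_op)"

definition CJ_morphism ::
    "('p::cstar_algebra, 'pp::cstar_algebra, 'ppp::cstar_algebra) cqg \<Rightarrow> 'p^('n::finite hf)^('n hf) \<Rightarrow>
     ('q::cstar_algebra, 'qq::cstar_algebra, 'qqq::cstar_algebra) cqg \<Rightarrow> 'q^('n hf)^('n hf) \<Rightarrow>
     ('p \<Rightarrow> 'q) \<Rightarrow> bool" where
  "CJ_morphism P W Q U f \<longleftrightarrow> cqg_morphism P Q f \<and> map_matrix f W = U"


section \<open>The complexified algebra and the category \<open>\<CC>_{J,\<real>}\<close>\<close>

text \<open>\<open>complex afc\<close> is \<open>(A_F)_\<complex> = \<complex> \<oplus> \<complex> \<oplus> M_2(\<complex>) \<oplus> M_3(\<complex>) \<oplus> M_3(\<complex>)\<close> and \<open>'q afc\<close> is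
  \<open>(A_F)_\<complex> \<otimes> Q\<close>.  The type has the product topology, which is the C*-topology.\<close>

type_synonym 'a afc = "'a \<times> 'a \<times> ('a^2^2) \<times> ('a^3^3) \<times> ('a^3^3)"

definition afc_map :: "('a \<Rightarrow> 'b) \<Rightarrow> 'a afc \<Rightarrow> 'b afc" where
  "afc_map f = (\<lambda>(l, l', q, m, m').
     (f l, f l', map_matrix f q, map_matrix f m, map_matrix f m'))"

definition afc_mult :: "'a::ring_1 afc \<Rightarrow> 'a afc \<Rightarrow> 'a afc" where
  "afc_mult = (\<lambda>(k, k', p, n, n') (l, l', q, m, m').
     (k * l, k' * l', p ** q, n ** m, n' ** m'))"

definition afc_star :: "'a::star afc \<Rightarrow> 'a afc" where
  "afc_star = (\<lambda>(l, l', q, m, m'). (star l, star l', adj q, adj m, adj m'))"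

text \<open>\<open>1 \<otimes> b\<close>\<close>

definition afc_const :: "'a::ring_1 \<Rightarrow> 'a afc" where
  "afc_const b = (b, b, mat b, mat b, mat b)"

definition sigma2 :: "complex^2^2" where
  "sigma2 = (\<chi> i j. if i = 1 \<and> j = 2 then - \<i> else if i = 2 \<and> j = 1 then \<i> else 0)"

text \<open>At \<open>'a = complex\<close> this is \<open>\<sigma>\<close>; at \<open>'a = Q\<close> it is \<open>\<sigma> \<otimes> *\<close>.\<close>

definition afc_sigma :: "'a::star_algebra afc \<Rightarrow> 'a afc" where
  "afc_sigma = (\<lambda>(l, l', q, m, m').
     (star l', star l, lift_mat sigma2 ** bar q ** lift_mat sigma2, bar m', bar m))"

definition A_F :: "(complex \<times> (complex^2^2) \<times> (complex^3^3)) set" where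
  "A_F = {(l, q, m). q $ 2 $ 2 = cnj (q $ 1 $ 1) \<and> q $ 2 $ 1 = - cnj (q $ 1 $ 2)}"

text \<open>The isomorphism \<open>A_F \<otimes>\<^sub>\<real> \<complex> \<simeq> (A_F)_\<complex>\<close> on elementary tensors.  It
  carries \<open>a \<otimes> z \<mapsto> a \<otimes> cnj z\<close> to \<^const>\<open>afc_sigma\<close>.\<close>

definition complexify :: "complex \<times> (complex^2^2) \<times> (complex^3^3) \<Rightarrow> complex \<Rightarrow> complex afc" where
  "complexify = (\<lambda>(l, q, m) z.
     (l * z, cnj l * z, map_matrix (\<lambda>c. c * z) q, map_matrix (\<lambda>c. c * z) m,
      map_matrix (\<lambda>c. cnj c * z) m))"

lemma afc_sigma_complexify:
  assumes "a \<in> A_F"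
  shows "afc_sigma (complexify a z) = complexify a (cnj z)"
proof -
  obtain l q m where a: "a = (l, q, m)" by (cases a)
  have i: "\<i> * x * \<i> = - x" for x
  proof -
    have "\<i> * x * \<i> = (\<i> * \<i>) * x" by (simp only: ac_simps)
    then show ?thesis by simp
  qed
  from a show ?thesis using assms
    by (auto simp: i A_F_def afc_sigma_def complexify_def bar_def lift_mat_def sigma2_def
        star_complex_def scaleC_complex_def vec_eq_iff matrix_matrix_mult_def sum_2 forall_2)
qed

text \<open>\<open>\<alpha> \<otimes> id\<close>, evaluated by expanding the argument in the matrix units of \<open>(A_F)_\<complex>\<close>.\<close>

definition afc_tensor_id ::
    "('q \<Rightarrow> 'q \<Rightarrow> 'qq) \<Rightarrow> (complex afc \<Rightarrow> 'q afc) \<Rightarrow> 'q afc \<Rightarrow> 'qq::real_vector afc" where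
  "afc_tensor_id t \<alpha> = (\<lambda>(l, l', q, m, m').
     (let T = (\<lambda>e b. afc_map (\<lambda>a. t a b) (\<alpha> e)) in
        T (1, 0, 0, 0, 0) l + T (0, 1, 0, 0, 0) l' +
        (\<Sum>i\<in>UNIV. \<Sum>j\<in>UNIV. T (0, 0, unit_mat i j, 0, 0) (q $ i $ j)) +
        (\<Sum>i\<in>UNIV. \<Sum>j\<in>UNIV. T (0, 0, 0, unit_mat i j, 0) (m $ i $ j)) +
        (\<Sum>i\<in>UNIV. \<Sum>j\<in>UNIV. T (0, 0, 0, 0, unit_mat i j) (m' $ i $ j))))"

text \<open>Coactions of \<open>Q\<close> on \<open>(A_F)_\<complex>\<close>; the real span in the density condition is a complex
  subspace.\<close>

definition afc_coaction ::
    "('q::cstar_algebra, 'qq::cstar_algebra, 'qqq::cstar_algebra) cqg \<Rightarrow>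
     (complex afc \<Rightarrow> 'q afc) \<Rightarrow> bool" where
  "afc_coaction Q \<alpha> \<longleftrightarrow>
     (\<forall>a b. \<alpha> (a + b) = \<alpha> a + \<alpha> b) \<and>
     (\<forall>c a. \<alpha> (afc_map (scaleC c) a) = afc_map (scaleC c) (\<alpha> a)) \<and>
     (\<forall>a b. \<alpha> (afc_mult a b) = afc_mult (\<alpha> a) (\<alpha> b)) \<and>
     \<alpha> (afc_const 1) = afc_const 1 \<and>
     (\<forall>a. \<alpha> (afc_star a) = afc_star (\<alpha> a)) \<and>
     (\<forall>a. afc_tensor_id (ten Q) \<alpha> (\<alpha> a) = afc_map (coprod Q) (\<alpha> a)) \<and>
     closure (span {afc_mult (\<alpha> a) (afc_const b) | a b. True}) = UNIV"

text \<open>\<open>B_F\<close> sits in \<open>(A_F)_\<complex>\<close> as the elements \<open>(\<lambda>, \<lambda>', q, m, 0)\<close>.\<close>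

definition extends_Ad :: "'q::star_algebra^('n::finite hf)^('n hf) \<Rightarrow> (complex afc \<Rightarrow> 'q afc) \<Rightarrow> bool"
  where
  "extends_Ad U \<alpha> \<longleftrightarrow>
     (\<forall>l l' q m. \<exists>k k' p n. Ad U (bf_op (l, l', q, m)) = bf_op (k, k', p, n) \<and>
        \<alpha> (l, l', q, m, 0) = (k, k', p, n, 0))"

definition CJR_object ::
    "'n::finite yukawa \<Rightarrow> ('q::cstar_algebra, 'qq::cstar_algebra, 'qqq::cstar_algebra) cqg \<Rightarrow>
     'q^('n hf)^('n hf) \<Rightarrow> bool" where
  "CJR_object Y Q U \<longleftrightarrow>
     CJ_object Y Q U \<and>
     (\<exists>\<alpha>. afc_coaction Q \<alpha> \<and> extends_Ad U \<alpha> \<and> (\<forall>a. afc_sigma (\<alpha> a) = \<alpha> (afc_sigma a)))"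


section \<open>The universal object of \<open>\<CC>_J\<close>\<close>

datatype 'n qiso_gen = gen_x0 | gen_x 'n | gen_T 'n 3 3 | gen_V 'n 'n

definition T_mat :: "('n qiso_gen \<Rightarrow> 'a) \<Rightarrow> 'n \<Rightarrow> 'a^3^3" where
  "T_mat g m = (\<chi> j k. g (gen_T m j k))"

definition V_mat :: "('n qiso_gen \<Rightarrow> 'a) \<Rightarrow> 'a^'n^'n" where
  "V_mat g = (\<chi> i j. g (gen_V i j))"

definition mat_diff :: "'a::minus^'i^'j \<Rightarrow> 'a^'i^'j \<Rightarrow> 'a set" where
  "mat_diff A B = {A $ i $ j - B $ i $ j | i j. True}"

definition unitary_diff :: "'a::star_algebra^'i^'i \<Rightarrow> 'a set" where
  "unitary_diff u = mat_diff (u ** adj u) (mat 1) \<union> mat_diff (adj u ** u) (mat 1)"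

definition biunitary_diff :: "'a::star_algebra^'i^'i \<Rightarrow> 'a set" where
  "biunitary_diff u = unitary_diff u \<union> unitary_diff (transpose u)"

text \<open>All relations are written as differences to be equated to zero.  The relation for \<open>\<Upsilon>_R\<close> is
  \<open>V \<Upsilon>_R = \<Upsilon>_R \<bar>V\<close>, with a bar on the right: this is the \<open>(2,4)\<close> block of the condition that
  \<open>D_F \<otimes> 1\<close> commutes with the corepresentation below, whose \<open>e_{11} \<otimes> e_{11} \<otimes> e_{22}\<close> and
  \<open>e_{11} \<otimes> e_{11} \<otimes> e_{44}\<close> components are \<open>V\<close> and \<open>\<bar>V\<close>.\<close>

definition qiso_relations :: "'n::finite yukawa \<Rightarrow> ('n qiso_gen \<Rightarrow> 'a::star_algebra) \<Rightarrow> 'a set" where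
  "qiso_relations Y g =
     (let d = diag_mat (\<lambda>k. g gen_x0 * g (gen_x k)); v = V_mat g; N = lift_mat (Ynu Y);
          R = lift_mat (YR Y); c = mixing Y in
        {star (g gen_x0) * g gen_x0 - 1, g gen_x0 * star (g gen_x0) - 1} \<union>
        (\<Union>k. {star (g (gen_x k)) * g (gen_x k) - 1, g (gen_x k) * star (g (gen_x k)) - 1}) \<union>
        (\<Union>m. biunitary_diff (T_mat g m)) \<union> biunitary_diff v \<union>
        mat_diff (d ** N) (N ** d) \<union> mat_diff (N ** d) (bar v ** N) \<union>
        mat_diff (bar v ** N) (N ** bar v) \<union>
        mat_diff (v ** R) (R ** bar v) \<union>
        {\<Sum>m\<in>UNIV. scaleC (cnj (c $ m $ r) * c $ m $ s) (g (gen_T m j k)) | r s j k. r \<noteq> s} \<union>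
        {adj (T_mat g m) $ i $ j * T_mat g m $ k $ l - adj (T_mat g m') $ i $ j * T_mat g m' $ k $ l
          | m m' i j k l. True})"

text \<open>The component of the corepresentation in the blocks \<open>c, c' \<in> {1, 2}\<close> of the third factor.\<close>

definition qiso_u :: "('n::finite qiso_gen \<Rightarrow> 'a::star_algebra) \<Rightarrow> 'a^('n hf)^('n hf)" where
  "qiso_u g =
     kron4 (unit_mat 1 1) (unit_mat 1 1) (unit_mat 1 1) (diag_mat (\<lambda>k. g gen_x0 * g (gen_x k))) +
     kron4 (unit_mat 1 1) (unit_mat 1 1) (unit_mat 2 2) (V_mat g) +
     kron4 (unit_mat 2 2) (unit_mat 1 1) (unit_mat 1 1) (diag_mat (\<lambda>k. g (gen_x k))) +
     kron4 (unit_mat 2 2) (unit_mat 1 1) (unit_mat 2 2) (diag_mat (\<lambda>k. star (g (gen_x k)))) +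
     (\<Sum>m\<in>UNIV.
        kron4 (unit_mat 1 1) (corner (T_mat g m)) (unit_mat 1 1) (unit_mat m m) +
        kron4 (unit_mat 1 1) (corner (bar (T_mat g m))) (unit_mat 2 2) (unit_mat m m)) +
     (\<Sum>m\<in>UNIV.
        kron4 (unit_mat 2 2) (corner (map_matrix (\<lambda>a. star (g gen_x0) * a) (T_mat g m)))
          (unit_mat 1 1) (unit_mat m m) +
        kron4 (unit_mat 2 2) (corner (map_matrix (\<lambda>a. a * g gen_x0) (bar (T_mat g m))))
          (unit_mat 2 2) (unit_mat m m))"

text \<open>The second summand is \<open>u\<^sup>*\<close> placed in the blocks \<open>c + 2, c' + 2\<close>; as \<open>c - 2 = c + 2\<close> in the
  index type \<open>4\<close>, it is read off from \<open>u\<close> at \<open>c + 2, c' + 2\<close>.\<close>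

definition qiso_corep :: "('n::finite qiso_gen \<Rightarrow> 'a::star_algebra) \<Rightarrow> 'a^('n hf)^('n hf)" where
  "qiso_corep g = qiso_u g +
     (\<chi> p q. case p of (a, b, c, d) \<Rightarrow> (case q of (a', b', c', d') \<Rightarrow>
        star (qiso_u g $ (a, b, c + 2, d) $ (a', b', c' + 2, d'))))"

definition is_QISO ::
    "'n::finite yukawa \<Rightarrow> ('p::cstar_algebra, 'pp::cstar_algebra, 'ppp::cstar_algebra) cqg \<Rightarrow>
     ('n qiso_gen \<Rightarrow> 'p) \<Rightarrow> bool" where
  "is_QISO Y P g \<longleftrightarrow>
     compact_quantum_group P \<and>
     universal_cstar_algebra (qiso_relations Y free_gen) g \<and>
     coprod P (g gen_x0) = ten P (g gen_x0) (g gen_x0) \<and>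
     (\<forall>k. coprod P (g (gen_x k)) = ten P (g (gen_x k)) (g (gen_x k))) \<and>
     (\<forall>m j k. coprod P (g (gen_T m j k)) = (\<Sum>l\<in>UNIV. ten P (g (gen_T m j l)) (g (gen_T m l k)))) \<and>
     (\<forall>i j. coprod P (g (gen_V i j)) = (\<Sum>l\<in>UNIV. ten P (g (gen_V i l)) (g (gen_V l j))))"

end

theory Submission
  imports Defs
begin

text \<open>By the shape of the adjoint coaction on \<open>B_F\<close>, compatibility with \<open>\<sigma>\<close> forces an extension
  \<open>\<alpha>\<close> to send the matrix unit \<open>e_ij\<close> of the fifth summand of \<open>(A_F)_\<complex>\<close> to the matrix with
  \<open>(k, l)\<close> entry \<open>(T_lj)\<^sup>* T_ki\<close>, where \<open>T\<close> is any of the \<open>T_m\<close>.  This map is multiplicative iff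
  \<open>\<Sum>s. (T_sj)\<^sup>* T_ki (T_lj')\<^sup>* T_si' = \<delta>_ji' (T_lj')\<^sup>* T_ki\<close>.  Multiplying by \<open>T_rj\<close> from the left
  and summing over \<open>j\<close> gives the half-commutation relations, by unitarity of \<open>T\<close>; conversely these
  relations allow the factor \<open>(T_sj)\<^sup>*\<close> to be moved next to \<open>T_si'\<close>.  The remaining axioms of a
  coaction follow from the biunitarity of \<open>T\<close> alone.\<close>

section \<open>Entries of the corepresentation and of elements of \<open>B_F\<close>\<close>

lemma up_eq_iff: "up i = up j \<longleftrightarrow> i = j"
  using exhaust_3[of i] exhaust_3[of j] by (auto simp: up_def)

lemma one_ne_up: "1 \<noteq> up j" "up j \<noteq> 1"
  using exhaust_3[of j] by (auto simp: up_def)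

lemma corner_up: "corner m $ up j $ b = (\<Sum>k\<in>UNIV. if b = up k then m $ j $ k else 0)"
  using exhaust_3[of j] by (auto simp: corner_def sum_3 up_def)

lemma corner_up_up: "corner m $ up j $ up k = m $ j $ k"
  by (simp add: corner_up up_eq_iff)

lemma corner_1: "corner m $ 1 $ b = 0"
  by (simp add: corner_def one_ne_up)

lemma kron4_nth: "kron4 A B C D $ (a, b, c, d) $ (a', b', c', d') =
    A $ a $ a' * (B $ b $ b' * (C $ c $ c' * D $ d $ d'))"
  by (simp add: kron4_def kron_def)

lemma unit_mat_diag_nth: "unit_mat m m $ d $ d' = (if m = d then if d' = d then 1 else 0 else 0)"
  by (auto simp: unit_mat_def)

lemma map_matrix_nth: "map_matrix f A $ i $ j = f (A $ i $ j)"
  by (simp add: map_matrix_def)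

lemma star_sum: "star (sum f A) = (\<Sum>a\<in>A. star (f a :: 'a::star_algebra))"
  by (induction A rule: infinite_finite_induct) (simp_all add: star_zero star_add)

lemma star_one: "star 1 = (1 :: 'a::star_algebra)"
  by (metis mult_1_left mult_1_right star_mult star_star)

text \<open>In the block with third index 2 the corepresentation acts on the \<open>T\<close>-part
  by \<open>bar (T_mat g d)\<close>, and the conjugated summand does not reach this row, since
  \<open>c + 2 = 4\<close> lies outside the support of \<open>qiso_u\<close>. These rows serve to
  read off the \<open>m\<close>-component of an operator in \<open>B_F\<close>.\<close>

lemma qiso_corep_row_T2:
  fixes g :: "'n::finite qiso_gen \<Rightarrow> 'a::star_algebra"
  shows "qiso_corep g $ (1, up j, 2, d) $ q =
    (\<Sum>k\<in>UNIV. if q = (1, up k, 2, d) then star (g (gen_T d j k)) else 0)"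
proof -
  obtain a' b' c' d' where q: "q = (a', b', c', d')" by (cases q)
  show ?thesis
    using exhaust_4[of c'] exhaust_2[of a']
    unfolding q qiso_corep_def qiso_u_def
    by (auto simp: kron4_nth unit_mat_diag_nth if_distrib[of "\<lambda>x. _ * x"] corner_1 corner_up
      bar_def map_matrix_nth T_mat_def star_zero diag_mat_def one_ne_up star_sum
      cong: if_cong intro!: sum.cong)
qed

text \<open>These rows serve to read off \<open>l\<close>, \<open>l'\<close> and \<open>q\<close>.
  Third index 4 belongs to the conjugated summand: \<open>4 + 2\<close> is 2 in the index type, so
  the entry is \<open>star (star (g (gen_x d)))\<close>.\<close>

lemma qiso_corep_row_x:
  fixes g :: "'n::finite qiso_gen \<Rightarrow> 'a::star_algebra"
  shows "qiso_corep g $ (2, 1, 2, d) $ q = (if q = (2, 1, 2, d) then star (g (gen_x d)) else 0)"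
    "qiso_corep g $ (2, 1, 4, d) $ q = (if q = (2, 1, 4, d) then g (gen_x d) else 0)"
    "qiso_corep g $ (1, 1, 1, d) $ q = (if q = (1, 1, 1, d) then g gen_x0 * g (gen_x d) else 0)"
    "qiso_corep g $ (2, 1, 1, d) $ q = (if q = (2, 1, 1, d) then g (gen_x d) else 0)"
proof -
  obtain a' b' c' d' where q: "q = (a', b', c', d')" by (cases q)
  show "qiso_corep g $ (2, 1, 2, d) $ q = (if q = (2, 1, 2, d) then star (g (gen_x d)) else 0)"
    "qiso_corep g $ (2, 1, 4, d) $ q = (if q = (2, 1, 4, d) then g (gen_x d) else 0)"
    "qiso_corep g $ (1, 1, 1, d) $ q = (if q = (1, 1, 1, d) then g gen_x0 * g (gen_x d) else 0)"
    "qiso_corep g $ (2, 1, 1, d) $ q = (if q = (2, 1, 1, d) then g (gen_x d) else 0)"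
    using exhaust_4[of c'] exhaust_2[of a']
    unfolding q qiso_corep_def qiso_u_def
    by (auto simp: kron4_nth unit_mat_diag_nth if_distrib[of "\<lambda>x. _ * x"] corner_1
      star_zero star_star diag_mat_def one_ne_up
      cong: if_cong)
qed

text \<open>At each of these positions only one component contributes, so together they show that
  the components of an operator in the range of \<open>bf_op\<close> are determined by it.\<close>

lemma bf_op_nth:
  shows "bf_op (l, l', q, m) $ (1, up j, 2, d) $ (1, up k, 2, d) = m $ j $ k"
    "bf_op (l, l', q, m) $ (2, 1, 2, d) $ (2, 1, 2, d) = l"
    "bf_op (l, l', q, m) $ (2, 1, 4, d) $ (2, 1, 4, d) = l'"
    "bf_op (l, l', q, m) $ (a, 1, 1, d) $ (a', 1, 1, d) = q $ a $ a'"
  by (simp_all add: kron4_nth unit_mat_diag_nth mat_def diag_mat_def corner_up_up corner_1 up_eq_iff one_ne_up)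

text \<open>Two rows of \<open>W\<close> with few non-zero entries reduce the double sum in
  \<open>W L W^*\<close> to their supports. Writing a row as a sum over \<open>k\<close> avoids any
  injectivity condition on \<open>f\<close> and \<open>f'\<close>.\<close>

lemma Ad_nth:
  fixes W :: "'q::star_algebra^'i^'i" and f :: "'a::finite \<Rightarrow> 'i" and f' :: "'b::finite \<Rightarrow> 'i"
  assumes "\<And>q. W $ p $ q = (\<Sum>k\<in>UNIV. if q = f k then c k else 0)"
    and "\<And>q. W $ p' $ q = (\<Sum>k\<in>UNIV. if q = f' k then c' k else 0)"
  shows "Ad W L $ p $ p' = (\<Sum>i\<in>UNIV. \<Sum>j\<in>UNIV. scaleC (L $ f i $ f' j) (c i * star (c' j)))"
proof -
  have *: "(\<Sum>q\<in>UNIV. (\<Sum>k\<in>UNIV. if q = h k then b k else 0) * F q) = (\<Sum>k\<in>UNIV. b k * F (h k))"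
    for h :: "'c::finite \<Rightarrow> 'i" and b :: "'c \<Rightarrow> 'q" and F
    unfolding sum_distrib_right
    by (subst sum.swap) (simp add: if_distrib[of "\<lambda>x. x * _"] cong: if_cong)
  have **: "(\<Sum>q\<in>UNIV. F q * star (\<Sum>k\<in>UNIV. if q = h k then b k else 0)) = (\<Sum>k\<in>UNIV. F (h k) * star (b k))"
    for h :: "'c::finite \<Rightarrow> 'i" and b :: "'c \<Rightarrow> 'q" and F
    unfolding sum_distrib_left star_sum
    by (subst sum.swap) (simp add: if_distrib star_zero if_distrib[of "\<lambda>x. _ * x"] cong: if_cong)
  show ?thesis
    unfolding Ad_def matrix_matrix_mult_def
    apply (simp add: assms * adj_def ** lift_mat_def map_matrix_nth)
    apply (simp add: mult_scaleC_left mult_scaleC_right sum_distrib_right)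
    apply (rule sum.swap)
    done
qed

section \<open>Star homomorphisms and biunitary matrices\<close>

lemma star_hom_zero: "star_hom f \<Longrightarrow> f 0 = 0"
  unfolding star_hom_def by (metis add_cancel_right_right)

lemma star_hom_sum: "star_hom f \<Longrightarrow> f (sum h A) = (\<Sum>a\<in>A. f (h a))"
  by (induction A rule: infinite_finite_induct) (auto simp: star_hom_zero, auto simp: star_hom_def)

lemma star_hom_diff: "star_hom f \<Longrightarrow> f (x - y) = f x - f y"
  unfolding star_hom_def by (metis add_diff_cancel_right' diff_add_cancel)

lemma star_hom_comp: "star_hom f \<Longrightarrow> star_hom h \<Longrightarrow> star_hom (f \<circ> h)"
  by (simp add: star_hom_def)

lemma scaleC_sum: "scaleC c (sum f A) = (\<Sum>a\<in>A. scaleC c (f a :: 'a::star_algebra))"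
  by (induction A rule: infinite_finite_induct) (simp_all add: scaleC_zero_right scaleC_add_right)

lemma scaleC_sum_left: "scaleC (sum c A) x = (\<Sum>a\<in>A. scaleC (c a) (x :: 'a::star_algebra))"
  by (induction A rule: infinite_finite_induct) (simp_all add: scaleC_zero_left scaleC_add_left)

lemma sum_rotate3: "(\<Sum>i\<in>A. \<Sum>j\<in>B. \<Sum>k\<in>C. f i j k) = (\<Sum>j\<in>B. \<Sum>k\<in>C. \<Sum>i\<in>A. f i j k)"
  by (rule trans[OF sum.swap], rule sum.cong[OF refl], rule sum.swap)

lemma sum_reverse3: "(\<Sum>i\<in>A. \<Sum>j\<in>B. \<Sum>k\<in>C. f i j k) = (\<Sum>k\<in>C. \<Sum>j\<in>B. \<Sum>i\<in>A. f i j k)"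
  by (rule trans[OF sum_rotate3], rule sum.swap)

lemma sum_rotate5: "(\<Sum>i\<in>A. \<Sum>j\<in>B. \<Sum>k\<in>C. \<Sum>l\<in>D. \<Sum>m\<in>M. f i j k l m) =
    (\<Sum>j\<in>B. \<Sum>k\<in>C. \<Sum>l\<in>D. \<Sum>m\<in>M. \<Sum>i\<in>A. f i j k l m)"
  by (rule trans[OF sum_rotate3], intro sum.cong refl) (rule sum_rotate3)

lemma unitary_mat_entries:
  assumes "unitary_mat u"
  shows "(\<Sum>s\<in>UNIV. u $ i $ s * star (u $ j $ s)) = (if i = j then 1 else 0)"
    "(\<Sum>s\<in>UNIV. star (u $ s $ i) * u $ s $ j) = (if i = j then 1 else 0)"
proof -
  have "(u ** adj u) $ i $ j = mat 1 $ i $ j" "(adj u ** u) $ i $ j = mat 1 $ i $ j"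
    using assms by (simp_all add: unitary_mat_def)
  then show "(\<Sum>s\<in>UNIV. u $ i $ s * star (u $ j $ s)) = (if i = j then 1 else 0)"
    "(\<Sum>s\<in>UNIV. star (u $ s $ i) * u $ s $ j) = (if i = j then 1 else 0)"
    by (simp_all add: matrix_matrix_mult_def adj_def mat_def)
qed

definition biunitary :: "'a::star_algebra^'i^'i \<Rightarrow> bool" where
  "biunitary u \<longleftrightarrow> unitary_mat u \<and> unitary_mat (transpose u)"

text \<open>The last two identities are the unitarity of the transpose. Over a noncommutative
  algebra they do not follow from the first two.\<close>

lemma biunitary_entries:
  assumes "biunitary u"
  shows "(\<Sum>s\<in>UNIV. u $ i $ s * star (u $ j $ s)) = (if i = j then 1 else 0)"
    "(\<Sum>s\<in>UNIV. star (u $ s $ i) * u $ s $ j) = (if i = j then 1 else 0)"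
    "(\<Sum>s\<in>UNIV. u $ s $ i * star (u $ s $ j)) = (if i = j then 1 else 0)"
    "(\<Sum>s\<in>UNIV. star (u $ i $ s) * u $ j $ s) = (if i = j then 1 else 0)"
  using assms unitary_mat_entries[of u] unitary_mat_entries[of "transpose u"]
  by (simp_all add: biunitary_def transpose_def)

text \<open>Applying \<open>f\<close> entrywise commutes with products and adjoints of matrices, so
  killing the differences makes the image unitary. It is meant for \<open>f\<close> on the free
  algebra, where \<open>u\<close> itself is not unitary.\<close>

lemma star_hom_unitary_mat:
  fixes u :: "'a::star_algebra^'b::finite^'b"
  assumes "star_hom f" "\<And>r. r \<in> unitary_diff u \<Longrightarrow> f r = 0"
  shows "unitary_mat (map_matrix f u)"
proof -
  have "f (mat 1 $ i $ j) = mat 1 $ i $ j" for i j :: 'b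
    using assms(1) by (simp add: mat_def star_hom_zero) (simp add: star_hom_def)
  moreover have "f ((u ** adj u) $ i $ j) - f (mat 1 $ i $ j) = 0"
    "f ((adj u ** u) $ i $ j) - f (mat 1 $ i $ j) = 0" for i j
    unfolding star_hom_diff[OF assms(1), symmetric]
    by (rule assms(2), auto simp: unitary_diff_def mat_diff_def)+
  moreover have "f ((v ** w) $ i $ j) = (map_matrix f v ** map_matrix f w) $ i $ j" for v w :: "'a^'b^'b" and i j
    using assms(1) by (simp add: matrix_matrix_mult_def map_matrix_nth star_hom_sum) (simp add: star_hom_def)
  moreover have "map_matrix f (adj u) = adj (map_matrix f u)"
    using assms(1) by (simp add: vec_eq_iff map_matrix_nth adj_def star_hom_def)
  ultimately show ?thesis
    by (simp add: unitary_mat_def vec_eq_iff)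
qed

lemma star_hom_biunitary:
  assumes "star_hom f" "\<And>r. r \<in> biunitary_diff u \<Longrightarrow> f r = 0"
  shows "biunitary (map_matrix f u)"
proof -
  have "transpose (map_matrix f u) = map_matrix f (transpose u)"
    by (simp add: transpose_def vec_eq_iff map_matrix_nth)
  with assms show ?thesis
    by (simp add: biunitary_def star_hom_unitary_mat biunitary_diff_def)
qed

section \<open>Coactions on a full matrix algebra\<close>

text \<open>The linear extension of \<open>e_ij\<close> to \<open>E i j\<close>; a coaction is thus
  encoded by the images of the matrix units.\<close>

definition lin_mat :: "('i \<Rightarrow> 'i \<Rightarrow> 'q::star_algebra^'i^'i) \<Rightarrow> complex^'i^'i \<Rightarrow> 'q^'i^'i" where
  "lin_mat E m = (\<chi> k l. \<Sum>i\<in>UNIV. \<Sum>j\<in>UNIV. scaleC (m $ i $ j) (E i j $ k $ l))"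

text \<open>\<open>e_ij \<mapsto> E i j\<close> is a coaction on a full matrix algebra, for the coproduct \<open>D\<close> and the tensor
  product \<open>t\<close>; the last clause is the density condition, which holds here without closure.\<close>

definition matrix_coaction ::
    "('q::star_algebra \<Rightarrow> 'r::star_algebra) \<Rightarrow> ('q \<Rightarrow> 'q \<Rightarrow> 'r) \<Rightarrow> ('i::finite \<Rightarrow> 'i \<Rightarrow> 'q^'i^'i) \<Rightarrow> bool" where
  "matrix_coaction D t E \<longleftrightarrow>
     (\<forall>i j i' j'. E i j ** E i' j' = (if j = i' then E i j' else 0)) \<and>
     (\<Sum>i\<in>UNIV. E i i) = mat 1 \<and>
     (\<forall>i j. adj (E i j) = E j i) \<and>
     (\<forall>i j k l. D (E i j $ k $ l) = (\<Sum>a\<in>UNIV. \<Sum>b\<in>UNIV. t (E a b $ k $ l) (E i j $ a $ b))) \<and>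
     (\<forall>q. \<exists>b. \<forall>k l. (\<Sum>i\<in>UNIV. \<Sum>j\<in>UNIV. E i j $ k $ l * b i j) = q $ k $ l)"

lemma lin_mat_add: "lin_mat E (a + b) = lin_mat E a + lin_mat E b"
  by (simp add: lin_mat_def vec_eq_iff scaleC_add_left sum.distrib)

lemma lin_mat_zero: "lin_mat E 0 = 0"
  by (simp add: lin_mat_def vec_eq_iff scaleC_zero_left)

lemma lin_mat_scaleC: "lin_mat E (map_matrix (scaleC c) a) = map_matrix (scaleC c) (lin_mat E a)"
  by (simp add: lin_mat_def vec_eq_iff map_matrix_nth scaleC_sum scaleC_scaleC scaleC_complex_def)

lemma lin_mat_unit:
  fixes E :: "'i::finite \<Rightarrow> 'i \<Rightarrow> 'q::star_algebra^'i^'i"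
  shows "lin_mat E (unit_mat i j) = E i j"
proof -
  have "scaleC (if k = i \<and> l = j then 1 else 0) x = (if k = i then if l = j then x else 0 else 0)"
    for k l and x :: 'q
    by (simp add: scaleC_one scaleC_zero_left)
  moreover have "(\<Sum>k\<in>UNIV. \<Sum>l\<in>UNIV. if k = i then if l = j then x k l else 0 else 0) =
    (\<Sum>k\<in>UNIV. if k = i then \<Sum>l\<in>UNIV. if l = j then x k l else 0 else 0)" for x :: "'i \<Rightarrow> 'i \<Rightarrow> 'q"
    by (rule sum.cong) auto
  ultimately show ?thesis
    by (simp add: lin_mat_def vec_eq_iff unit_mat_def)
qed

lemma lin_mat_bar: "bar (lin_mat E m) = lin_mat (\<lambda>i j. bar (E i j)) (bar m)"
  by (simp add: lin_mat_def bar_def vec_eq_iff map_matrix_nth star_sum star_scaleC star_complex_def)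

lemma lin_mat_one:
  assumes "matrix_coaction D t E"
  shows "lin_mat E (mat 1) = mat 1"
proof -
  have "lin_mat E (mat 1) = (\<Sum>i\<in>UNIV. E i i)"
    by (simp add: lin_mat_def vec_eq_iff mat_def if_distrib[of "\<lambda>c. scaleC c _"] scaleC_one
      scaleC_zero_left cong: if_cong)
  with assms show ?thesis by (simp add: matrix_coaction_def)
qed

lemma lin_mat_adj:
  assumes "matrix_coaction D t E"
  shows "lin_mat E (adj m) = adj (lin_mat E m)"
proof -
  have "star (E i j $ l $ k) = E j i $ k $ l" for i j k l
    using assms by (simp add: matrix_coaction_def adj_def vec_eq_iff)
  then show ?thesis
    by (simp add: lin_mat_def vec_eq_iff adj_def star_sum star_scaleC star_complex_def)
      (intro allI, rule sum.swap)
qed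

lemma lin_mat_mult:
  assumes "matrix_coaction D t E"
  shows "lin_mat E (m ** n) = lin_mat E m ** lin_mat E n"
proof -
  have E: "(\<Sum>s\<in>UNIV. E i j $ k $ s * E i' j' $ s $ l) = (if j = i' then E i j' $ k $ l else 0)"
    for i j i' j' k l
  proof -
    have "(E i j ** E i' j') $ k $ l = (if j = i' then E i j' $ k $ l else 0)"
      using assms by (simp add: matrix_coaction_def)
    then show ?thesis by (simp add: matrix_matrix_mult_def)
  qed
  have "(lin_mat E m ** lin_mat E n) $ k $ l = lin_mat E (m ** n) $ k $ l" for k l
  proof -
    have "(lin_mat E m ** lin_mat E n) $ k $ l =
      (\<Sum>s\<in>UNIV. \<Sum>i\<in>UNIV. \<Sum>i'\<in>UNIV. \<Sum>j\<in>UNIV. \<Sum>j'\<in>UNIV.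
        scaleC (m $ i $ j * n $ i' $ j') (E i j $ k $ s * E i' j' $ s $ l))"
      by (simp add: matrix_matrix_mult_def lin_mat_def sum_product
       mult_scaleC_left mult_scaleC_right scaleC_scaleC mult.commute[of "n $ _ $ _"])
    \<comment> \<open>With the sum over \<open>s\<close> innermost, the multiplication table of the
      \<open>E i j\<close> applies.\<close>
    also have "\<dots> = (\<Sum>i\<in>UNIV. \<Sum>i'\<in>UNIV. \<Sum>j\<in>UNIV. \<Sum>j'\<in>UNIV. \<Sum>s\<in>UNIV.
        scaleC (m $ i $ j * n $ i' $ j') (E i j $ k $ s * E i' j' $ s $ l))"
      by (rule sum_rotate5)
    also have "\<dots> = (\<Sum>i\<in>UNIV. \<Sum>i'\<in>UNIV. \<Sum>j\<in>UNIV. if j = i' then \<Sum>j'\<in>UNIV.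
        scaleC (m $ i $ j * n $ i' $ j') (E i j' $ k $ l) else 0)"
      by (intro sum.cong refl) (simp add: scaleC_zero_right E flip: scaleC_sum)
    also have "\<dots> = (\<Sum>i\<in>UNIV. \<Sum>j'\<in>UNIV. \<Sum>i'\<in>UNIV. scaleC (m $ i $ i' * n $ i' $ j') (E i j' $ k $ l))"
      by simp (rule sum.cong[OF refl], rule sum.swap)
    also have "\<dots> = lin_mat E (m ** n) $ k $ l"
      by (simp add: lin_mat_def matrix_matrix_mult_def scaleC_sum_left)
    finally show ?thesis .
  qed
  then show ?thesis by (simp add: vec_eq_iff)
qed

text \<open>Conjugation of the matrix unit \<open>e_ij\<close> by \<open>bar T\<close>.\<close>

definition ad_units :: "'q::star_algebra^'i^'i \<Rightarrow> 'i \<Rightarrow> 'i \<Rightarrow> 'q^'i^'i" where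
  "ad_units T i j = (\<chi> k l. star (T $ k $ i) * T $ l $ j)"

text \<open>Conjugation by a biunitary corepresentation matrix: column orthogonality of the form
  \<open>T T^*\<close> makes it multiplicative, row orthogonality of the form \<open>T^* T\<close>
  makes it unital, and both row identities together invert it for the density clause.\<close>

lemma matrix_coaction_ad_units:
  assumes T: "biunitary T"
    and D: "star_hom D" "\<And>j k. D (T $ j $ k) = (\<Sum>l\<in>UNIV. t (T $ j $ l) (T $ l $ k))"
    and t: "\<And>a a' b b'. t a b * t a' b' = t (a * a') (b * b')" "\<And>a b. star (t a b) = t (star a) (star b)"
  shows "matrix_coaction D t (ad_units T)"
  unfolding matrix_coaction_def
proof (intro conjI allI)
  fix i j i' j'
  have "(\<Sum>s\<in>UNIV. star (T $ k $ i) * T $ s $ j * (star (T $ s $ i') * T $ l $ j')) =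
     star (T $ k $ i) * (\<Sum>s\<in>UNIV. T $ s $ j * star (T $ s $ i')) * T $ l $ j'" for k l
    by (simp add: sum_distrib_left sum_distrib_right mult.assoc)
  then show "ad_units T i j ** ad_units T i' j' = (if j = i' then ad_units T i j' else 0)"
    by (simp add: matrix_matrix_mult_def ad_units_def vec_eq_iff biunitary_entries[OF T])
next
  show "(\<Sum>i\<in>UNIV. ad_units T i i) = mat 1"
    by (simp add: ad_units_def vec_eq_iff mat_def biunitary_entries[OF T])
next
  fix i j
  show "adj (ad_units T i j) = ad_units T j i"
    by (simp add: adj_def ad_units_def vec_eq_iff star_mult star_star)
next
  fix i j k l
  show "D (ad_units T i j $ k $ l) = (\<Sum>a\<in>UNIV. \<Sum>b\<in>UNIV. t (ad_units T a b $ k $ l) (ad_units T i j $ a $ b))"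
    using D by (simp add: ad_units_def star_hom_def star_sum t sum_product)
next
  fix q :: "'a^'b^'b"
  \<comment> \<open>The order of the factors in the coefficients is chosen so that
    \<open>T $ l $ j\<close> meets \<open>star (T $ b $ j)\<close> first; once the sum over
    \<open>j\<close> has collapsed, \<open>star (T $ k $ i)\<close> meets
    \<open>T $ a $ i\<close>.\<close>
  have *: "(\<Sum>i\<in>UNIV. \<Sum>j\<in>UNIV. star (T $ k $ i) * T $ l $ j * (\<Sum>a\<in>UNIV. \<Sum>b\<in>UNIV. star (T $ b $ j) * T $ a $ i * q $ a $ b))
     = q $ k $ l" for k l
  proof -
    have "(\<Sum>i\<in>UNIV. \<Sum>j\<in>UNIV. star (T $ k $ i) * T $ l $ j * (\<Sum>a\<in>UNIV. \<Sum>b\<in>UNIV. star (T $ b $ j) * T $ a $ i * q $ a $ b)) =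
       (\<Sum>i\<in>UNIV. \<Sum>a\<in>UNIV. \<Sum>b\<in>UNIV. star (T $ k $ i) * (\<Sum>j\<in>UNIV. T $ l $ j * star (T $ b $ j)) * T $ a $ i * q $ a $ b)"
      apply (simp add: sum_distrib_left sum_distrib_right mult.assoc)
      apply (rule sum.cong[OF refl], rule sum_rotate3)
      done
    also have "\<dots> = (\<Sum>i\<in>UNIV. \<Sum>a\<in>UNIV. star (T $ k $ i) * T $ a $ i * q $ a $ l)"
      by (simp add: biunitary_entries[OF T] if_distrib[of "\<lambda>x. _ * x"] if_distrib[of "\<lambda>x. x * _"]
          cong: if_cong)
    also have "\<dots> = (\<Sum>a\<in>UNIV. \<Sum>i\<in>UNIV. star (T $ k $ i) * T $ a $ i * q $ a $ l)"
      by (rule sum.swap)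
    also have "\<dots> = q $ k $ l"
      by (simp add: biunitary_entries[OF T] if_distrib[of "\<lambda>x. x * _"] cong: if_cong flip: sum_distrib_right)
    finally show ?thesis .
  qed
  show "\<exists>b. \<forall>k l. (\<Sum>i\<in>UNIV. \<Sum>j\<in>UNIV. ad_units T i j $ k $ l * b i j) = q $ k $ l"
    by (intro exI[of _ "\<lambda>i j. \<Sum>a\<in>UNIV. \<Sum>b\<in>UNIV. star (T $ b $ j) * T $ a $ i * q $ a $ b"])
      (simp add: ad_units_def *)
qed

text \<open>The entries are the adjoints \<open>star (T $ l $ j) * T $ k $ i\<close>.
  Multiplicativity is the point where half-commutation enters; the coproduct formula is the adjoint
  of the one for \<open>ad_units\<close>.\<close>

lemma matrix_coaction_bar_ad_units:
  assumes T: "biunitary T"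
    and D: "star_hom D" "\<And>j k. D (T $ j $ k) = (\<Sum>l\<in>UNIV. t (T $ j $ l) (T $ l $ k))"
    and t: "\<And>a a' b b'. t a b * t a' b' = t (a * a') (b * b')" "\<And>a b. star (t a b) = t (star a) (star b)"
    and half: "\<And>j j' j'' k k' k''. T $ j $ k * star (T $ j' $ k') * T $ j'' $ k'' =
      T $ j'' $ k'' * star (T $ j' $ k') * T $ j $ k"
  shows "matrix_coaction D t (\<lambda>i j. bar (ad_units T i j))"
  unfolding matrix_coaction_def
proof (intro conjI allI)
  fix i j i' j'
  \<comment> \<open>The adjoint of \<open>half\<close>; it carries \<open>star (T $ s $ j)\<close>
    past two factors, next to \<open>T $ s $ i'\<close>, where the sum over \<open>s\<close> becomes
    a Kronecker delta.\<close>
  have h: "star (T $ a $ b) * T $ c $ d * star (T $ e $ f) = star (T $ e $ f) * T $ c $ d * star (T $ a $ b)" for a b c d e f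
    using arg_cong[OF half[of a b c d e f], of star] by (simp add: star_mult star_star mult.assoc)
  have "(\<Sum>s\<in>UNIV. star (T $ s $ j) * T $ k $ i * (star (T $ l $ j') * T $ s $ i')) =
     star (T $ l $ j') * T $ k $ i * (\<Sum>s\<in>UNIV. star (T $ s $ j) * T $ s $ i')" for k l
    by (simp add: sum_distrib_left h flip: mult.assoc)
  then show "bar (ad_units T i j) ** bar (ad_units T i' j') = (if j = i' then bar (ad_units T i j') else 0)"
    by (simp add: matrix_matrix_mult_def ad_units_def bar_def map_matrix_nth vec_eq_iff
       biunitary_entries[OF T] star_mult star_star)
next
  show "(\<Sum>i\<in>UNIV. bar (ad_units T i i)) = mat 1"
    by (auto simp: ad_units_def bar_def map_matrix_nth vec_eq_iff mat_def biunitary_entries[OF T] star_mult star_star)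
next
  fix i j
  show "adj (bar (ad_units T i j)) = bar (ad_units T j i)"
    by (simp add: adj_def ad_units_def bar_def map_matrix_nth vec_eq_iff star_mult star_star)
next
  fix i j k l
  have "D (ad_units T i j $ k $ l) = (\<Sum>a\<in>UNIV. \<Sum>b\<in>UNIV. t (ad_units T a b $ k $ l) (ad_units T i j $ a $ b))"
    using matrix_coaction_ad_units[OF T D t] by (simp add: matrix_coaction_def)
  moreover have "D (star x) = star (D x)" for x
    using D by (simp add: star_hom_def)
  ultimately show "D (bar (ad_units T i j) $ k $ l) = (\<Sum>a\<in>UNIV. \<Sum>b\<in>UNIV. t (bar (ad_units T a b) $ k $ l) (bar (ad_units T i j) $ a $ b))"
    by (simp add: bar_def map_matrix_nth star_sum t)
next
  fix q :: "'a^'b^'b"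
  \<comment> \<open>As for \<open>ad_units\<close>, with the roles of \<open>i\<close> and
    \<open>j\<close> exchanged: the sum over \<open>i\<close> collapses first.\<close>
  have *: "(\<Sum>i\<in>UNIV. \<Sum>j\<in>UNIV. star (T $ l $ j) * T $ k $ i * (\<Sum>a\<in>UNIV. \<Sum>b\<in>UNIV. star (T $ a $ i) * T $ b $ j * q $ a $ b))
     = q $ k $ l" for k l
  proof -
    have "(\<Sum>i\<in>UNIV. \<Sum>j\<in>UNIV. star (T $ l $ j) * T $ k $ i * (\<Sum>a\<in>UNIV. \<Sum>b\<in>UNIV. star (T $ a $ i) * T $ b $ j * q $ a $ b)) =
       (\<Sum>j\<in>UNIV. \<Sum>b\<in>UNIV. \<Sum>a\<in>UNIV. star (T $ l $ j) * (\<Sum>i\<in>UNIV. T $ k $ i * star (T $ a $ i)) * T $ b $ j * q $ a $ b)"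
      apply (simp add: sum_distrib_left sum_distrib_right mult.assoc)
      apply (rule trans[OF sum.swap], rule sum.cong[OF refl], rule sum_reverse3)
      done
    also have "\<dots> = (\<Sum>j\<in>UNIV. \<Sum>b\<in>UNIV. star (T $ l $ j) * T $ b $ j * q $ k $ b)"
      by (simp add: biunitary_entries[OF T] if_distrib[of "\<lambda>x. _ * x"] if_distrib[of "\<lambda>x. x * _"]
          cong: if_cong)
    also have "\<dots> = (\<Sum>b\<in>UNIV. \<Sum>j\<in>UNIV. star (T $ l $ j) * T $ b $ j * q $ k $ b)"
      by (rule sum.swap)
    also have "\<dots> = q $ k $ l"
      by (simp add: biunitary_entries[OF T] if_distrib[of "\<lambda>x. x * _"] cong: if_cong flip: sum_distrib_right)
    finally show ?thesis .
  qed
  show "\<exists>b. \<forall>k l. (\<Sum>i\<in>UNIV. \<Sum>j\<in>UNIV. bar (ad_units T i j) $ k $ l * b i j) = q $ k $ l"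
    by (intro exI[of _ "\<lambda>i j. \<Sum>a\<in>UNIV. \<Sum>b\<in>UNIV. star (T $ a $ i) * T $ b $ j * q $ a $ b"])
      (simp add: ad_units_def bar_def map_matrix_nth star_mult star_star *)
qed

section \<open>Coactions on the complexified algebra\<close>

text \<open>A direct sum of coactions, trivial on the two one-dimensional summands.\<close>

definition afc_lin ::
    "(2 \<Rightarrow> 2 \<Rightarrow> 'q::star_algebra^2^2) \<Rightarrow> (3 \<Rightarrow> 3 \<Rightarrow> 'q^3^3) \<Rightarrow> (3 \<Rightarrow> 3 \<Rightarrow> 'q^3^3) \<Rightarrow>
     complex afc \<Rightarrow> 'q afc" where
  "afc_lin E F G = (\<lambda>(l, l', q, m, m').
     (scaleC l 1, scaleC l' 1, lin_mat E q, lin_mat F m, lin_mat G m'))"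

lemma min_tensorD:
  assumes "min_tensor t"
  shows "t (a + a') b = t a b + t a' b" "t a (b + b') = t a b + t a b'"
    "t (scaleC c a) b = scaleC c (t a b)" "t a (scaleC c b) = scaleC c (t a b)"
    "t a b * t a' b' = t (a * a') (b * b')" "star (t a b) = t (star a) (star b)" "t 1 1 = 1"
  using assms by (simp_all add: min_tensor_def)

lemma min_tensor_zero:
  assumes "min_tensor t"
  shows "t 0 b = 0" "t a 0 = 0"
  using min_tensorD(1)[OF assms, of 0 0] min_tensorD(2)[OF assms, of _ 0 0] by simp_all

lemma min_tensor_sum_right:
  assumes "min_tensor t"
  shows "t a (sum f A) = (\<Sum>x\<in>A. t a (f x))"
  by (induction A rule: infinite_finite_induct) (simp_all add: min_tensor_zero[OF assms] min_tensorD[OF assms])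

lemma fst_sum: "fst (sum f A) = (\<Sum>x\<in>A. fst (f x))"
  by (induction A rule: infinite_finite_induct) simp_all

lemma snd_sum: "snd (sum f A) = (\<Sum>x\<in>A. snd (f x))"
  by (induction A rule: infinite_finite_induct) simp_all

text \<open>The coaction identity in one entry: the left-hand side is the expansion in matrix units
  by which \<open>afc_tensor_id\<close> evaluates \<open>\<alpha> \<otimes> id\<close>.\<close>

lemma matrix_coaction_coprod:
  assumes "matrix_coaction D t E" "star_hom D" "min_tensor t"
  shows "(\<Sum>i\<in>UNIV. \<Sum>j\<in>UNIV. t (E i j $ k $ l) (lin_mat E m $ i $ j)) = D (lin_mat E m $ k $ l)"
proof -
  have D: "D (scaleC c x) = scaleC c (D x)" for c x
    using assms(2) by (simp add: star_hom_def)
  have DE: "D (E i j $ k $ l) = (\<Sum>a\<in>UNIV. \<Sum>b\<in>UNIV. t (E a b $ k $ l) (E i j $ a $ b))" for i j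
    using assms(1) unfolding matrix_coaction_def by blast
  have "(\<Sum>i\<in>UNIV. \<Sum>j\<in>UNIV. t (E i j $ k $ l) (lin_mat E m $ i $ j)) =
     (\<Sum>i\<in>UNIV. \<Sum>j\<in>UNIV. \<Sum>a\<in>UNIV. \<Sum>b\<in>UNIV. scaleC (m $ a $ b) (t (E i j $ k $ l) (E a b $ i $ j)))"
    by (simp add: lin_mat_def min_tensor_sum_right[OF assms(3)] min_tensorD[OF assms(3)])
  also have "\<dots> = (\<Sum>i\<in>UNIV. \<Sum>a\<in>UNIV. \<Sum>b\<in>UNIV. \<Sum>j\<in>UNIV. scaleC (m $ a $ b) (t (E i j $ k $ l) (E a b $ i $ j)))"
    by (rule sum.cong[OF refl], rule sum_rotate3)
  also have "\<dots> = (\<Sum>a\<in>UNIV. \<Sum>b\<in>UNIV. \<Sum>i\<in>UNIV. \<Sum>j\<in>UNIV. scaleC (m $ a $ b) (t (E i j $ k $ l) (E a b $ i $ j)))"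
    by (rule sum_rotate3)
  also have "\<dots> = D (lin_mat E m $ k $ l)"
    by (simp add: lin_mat_def star_hom_sum[OF assms(2)] D DE scaleC_sum)
  finally show ?thesis .
qed

text \<open>Right multiplication by the scalar matrix \<open>mat (b i j)\<close> is multiplication
  by \<open>1 \<otimes> b i j\<close>, which is the form needed for the span in
  \<open>afc_coaction\<close>.\<close>

lemma matrix_coaction_dense:
  assumes "matrix_coaction D t E"
  obtains b where "(\<Sum>i\<in>UNIV. \<Sum>j\<in>UNIV. E i j ** mat (b i j)) = q"
proof -
  have "\<exists>b. \<forall>k l. (\<Sum>i\<in>UNIV. \<Sum>j\<in>UNIV. E i j $ k $ l * b i j) = q $ k $ l"
    using assms unfolding matrix_coaction_def by blast
  then obtain b where b: "(\<Sum>i\<in>UNIV. \<Sum>j\<in>UNIV. E i j $ k $ l * b i j) = q $ k $ l" for k l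
    by blast
  have "(E i j ** mat (b i j)) $ k $ l = E i j $ k $ l * b i j" for i j k l
    by (simp add: matrix_matrix_mult_def mat_def if_distrib[of "\<lambda>x. _ * x"] cong: if_cong)
  then have "(\<Sum>i\<in>UNIV. \<Sum>j\<in>UNIV. E i j ** mat (b i j)) = q"
    by (simp add: vec_eq_iff b)
  then show ?thesis by (rule that)
qed

lemma scaleC_complex_scaleC: "scaleC (scaleC c d) x = scaleC (c * d) (x :: 'a::star_algebra)"
  by (simp add: scaleC_complex_def)

lemma matrix_mult_zero_left: "(0 :: 'a::semiring_1^'i^'j) ** M = 0"
  by (simp add: vec_eq_iff matrix_matrix_mult_def)

lemma afc_coaction_lin:
  assumes Q: "compact_quantum_group Q"
    and E: "matrix_coaction (coprod Q) (ten Q) E"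
    and F: "matrix_coaction (coprod Q) (ten Q) F"
    and G: "matrix_coaction (coprod Q) (ten Q) G"
  shows "afc_coaction Q (afc_lin E F G)"
  unfolding afc_coaction_def
proof (intro conjI allI)
  have t: "min_tensor (ten Q)" and D: "star_hom (coprod Q)"
    using Q by (simp_all add: compact_quantum_group_def)
  fix a b :: "complex afc"
  obtain l l' q m m' where a: "a = (l, l', q, m, m')" by (cases a)
  obtain k k' p n n' where b: "b = (k, k', p, n, n')" by (cases b)
  show "afc_lin E F G (a + b) = afc_lin E F G a + afc_lin E F G b"
    by (simp add: a b afc_lin_def lin_mat_add scaleC_add_left)
  show "afc_lin E F G (afc_map (scaleC c) a) = afc_map (scaleC c) (afc_lin E F G a)" for c
    by (simp add: a afc_lin_def afc_map_def lin_mat_scaleC scaleC_scaleC scaleC_complex_scaleC)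
  show "afc_lin E F G (afc_mult a b) = afc_mult (afc_lin E F G a) (afc_lin E F G b)"
    by (simp add: a b afc_lin_def afc_mult_def lin_mat_mult[OF E] lin_mat_mult[OF F]
       lin_mat_mult[OF G] mult_scaleC_left scaleC_scaleC)
  show "afc_lin E F G (afc_const 1) = afc_const 1"
    by (simp add: afc_lin_def afc_const_def lin_mat_one[OF E] lin_mat_one[OF F]
       lin_mat_one[OF G] scaleC_one)
  show "afc_lin E F G (afc_star a) = afc_star (afc_lin E F G a)"
    by (simp add: a afc_lin_def afc_star_def lin_mat_adj[OF E] lin_mat_adj[OF F]
       lin_mat_adj[OF G] star_scaleC star_one star_complex_def)
  have D1: "coprod Q (scaleC c 1) = scaleC c 1" for c
    using D by (simp add: star_hom_def)
  show "afc_tensor_id (ten Q) (afc_lin E F G) (afc_lin E F G a) = afc_map (coprod Q) (afc_lin E F G a)"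
    using matrix_coaction_coprod[OF E D t] matrix_coaction_coprod[OF F D t] matrix_coaction_coprod[OF G D t]
    by (simp add: a afc_tensor_id_def Let_def afc_lin_def afc_map_def lin_mat_unit lin_mat_zero D1
      scaleC_one scaleC_zero_left scaleC_zero_right min_tensorD[OF t] min_tensor_zero[OF t] prod_eq_iff fst_sum snd_sum
      vec_eq_iff map_matrix_nth)
next
  let ?S = "{afc_mult (afc_lin E F G a) (afc_const b) | a b. True}"
  have S: "afc_mult (afc_lin E F G a) (afc_const b) \<in> span ?S" for a b
    by (intro span_base) blast
  have "x \<in> span ?S" for x
  proof -
    obtain l l' q m m' where x: "x = (l, l', q, m, m')" by (cases x)
    obtain b where b: "(\<Sum>i\<in>UNIV. \<Sum>j\<in>UNIV. E i j ** mat (b i j)) = q"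
      by (rule matrix_coaction_dense[OF E])
    obtain c where c: "(\<Sum>i\<in>UNIV. \<Sum>j\<in>UNIV. F i j ** mat (c i j)) = m"
      by (rule matrix_coaction_dense[OF F])
    obtain d where d: "(\<Sum>i\<in>UNIV. \<Sum>j\<in>UNIV. G i j ** mat (d i j)) = m'"
      by (rule matrix_coaction_dense[OF G])
    \<comment> \<open>A unit of one summand has image zero in the other summands, so the
      coefficients can be chosen for each summand separately.\<close>
    have "x = afc_mult (afc_lin E F G (1, 0, 0, 0, 0)) (afc_const l) +
      afc_mult (afc_lin E F G (0, 1, 0, 0, 0)) (afc_const l') +
      (\<Sum>i\<in>UNIV. \<Sum>j\<in>UNIV. afc_mult (afc_lin E F G (0, 0, unit_mat i j, 0, 0)) (afc_const (b i j))) +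
      (\<Sum>i\<in>UNIV. \<Sum>j\<in>UNIV. afc_mult (afc_lin E F G (0, 0, 0, unit_mat i j, 0)) (afc_const (c i j))) +
      (\<Sum>i\<in>UNIV. \<Sum>j\<in>UNIV. afc_mult (afc_lin E F G (0, 0, 0, 0, unit_mat i j)) (afc_const (d i j)))"
      by (simp add: x afc_mult_def afc_lin_def afc_const_def lin_mat_unit lin_mat_zero
        scaleC_one scaleC_zero_left prod_eq_iff fst_sum snd_sum b c d matrix_mult_zero_left)
    also have "\<dots> \<in> span ?S"
      by (intro span_add span_sum S)
    finally show ?thesis .
  qed
  then have "span ?S = UNIV" by blast
  then show "closure (span ?S) = UNIV" by simp
qed

section \<open>Relations and coproducts of the generators in \<open>Q\<close>\<close>

lemma coprod_qiso_gen:
  assumes "is_QISO Y P g" "cqg_morphism P Q \<phi>"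
  shows "coprod Q (\<phi> (g gen_x0)) = ten Q (\<phi> (g gen_x0)) (\<phi> (g gen_x0))"
    "coprod Q (\<phi> (g (gen_T m j k))) = (\<Sum>l\<in>UNIV. ten Q (\<phi> (g (gen_T m j l))) (\<phi> (g (gen_T m l k))))"
proof -
  obtain H where H: "star_hom H" "\<And>a b. H (ten P a b) = ten Q (\<phi> a) (\<phi> b)" "\<And>a. coprod Q (\<phi> a) = H (coprod P a)"
    using assms(2) by (auto simp: cqg_morphism_def is_tensor_map_def)
  show "coprod Q (\<phi> (g gen_x0)) = ten Q (\<phi> (g gen_x0)) (\<phi> (g gen_x0))"
    "coprod Q (\<phi> (g (gen_T m j k))) = (\<Sum>l\<in>UNIV. ten Q (\<phi> (g (gen_T m j l))) (\<phi> (g (gen_T m l k))))"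
    using assms(1) by (simp_all add: is_QISO_def H star_hom_sum)
qed

text \<open>The composition of \<open>\<phi>\<close> with the evaluation map is a star homomorphism
  on the free algebra that kills every relation, so the relations hold for the images of the
  generators.\<close>

lemma qiso_relations_image:
  assumes "universal_cstar_algebra (qiso_relations Y free_gen) g" "star_hom \<phi>"
  shows "star (\<phi> (g gen_x0)) * \<phi> (g gen_x0) = 1" "\<phi> (g gen_x0) * star (\<phi> (g gen_x0)) = 1"
    "star (\<phi> (g (gen_x d))) * \<phi> (g (gen_x d)) = 1" "\<phi> (g (gen_x d)) * star (\<phi> (g (gen_x d))) = 1"
    "biunitary (T_mat (\<phi> \<circ> g) d)"
proof -
  obtain ev where ev: "star_hom ev" "\<And>s. ev (free_gen s) = g s" "\<And>r. r \<in> qiso_relations Y free_gen \<Longrightarrow> ev r = 0"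
    using assms(1) unfolding universal_cstar_algebra_def by blast
  define f where "f = \<phi> \<circ> ev"
  have f: "star_hom f" "\<And>s. f (free_gen s) = \<phi> (g s)"
    using ev assms(2) by (simp_all add: f_def star_hom_comp)
  have rel: "f r = 0" if "r \<in> qiso_relations Y free_gen" for r
    using ev(3)[OF that] assms(2) by (simp add: f_def star_hom_zero)
  have f_eq_1: "f x = 1" if "x - 1 \<in> qiso_relations Y free_gen" for x
    using rel[OF that] f(1) by (simp add: star_hom_diff) (simp add: star_hom_def)
  have fs: "f (x * y) = f x * f y" "f (star x) = star (f x)" for x y
    using f(1) by (simp_all add: star_hom_def)
  have "f (star (free_gen gen_x0) * free_gen gen_x0) = 1" "f (free_gen gen_x0 * star (free_gen gen_x0)) = 1"
    "f (star (free_gen (gen_x d)) * free_gen (gen_x d)) = 1" "f (free_gen (gen_x d) * star (free_gen (gen_x d))) = 1"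
    by (rule f_eq_1, auto simp: qiso_relations_def Let_def)+
  then show "star (\<phi> (g gen_x0)) * \<phi> (g gen_x0) = 1" "\<phi> (g gen_x0) * star (\<phi> (g gen_x0)) = 1"
    "star (\<phi> (g (gen_x d))) * \<phi> (g (gen_x d)) = 1" "\<phi> (g (gen_x d)) * star (\<phi> (g (gen_x d))) = 1"
    by (simp_all only: fs f(2))
  have "biunitary (map_matrix f (T_mat free_gen d))"
    by (rule star_hom_biunitary[OF f(1)], rule rel) (auto simp: qiso_relations_def Let_def)
  moreover have "map_matrix f (T_mat free_gen d) = T_mat (\<phi> \<circ> g) d"
    by (simp add: vec_eq_iff T_mat_def map_matrix_nth f)
  ultimately show "biunitary (T_mat (\<phi> \<circ> g) d)" by simp
qed

text \<open>The coaction on the summand \<open>M_2(\<complex>)\<close> is \<open>ad_units (x_mat x_0)\<close>.\<close>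

definition x_mat :: "'q::star_algebra \<Rightarrow> 'q^2^2" where
  "x_mat x = diag_mat (\<lambda>i. if i = 1 then star x else 1)"

lemma biunitary_x_mat:
  assumes "star x * x = 1" "x * star x = 1"
  shows "biunitary (x_mat x)"
  using assms by (auto simp: biunitary_def unitary_mat_def x_mat_def vec_eq_iff matrix_matrix_mult_def adj_def
    transpose_def diag_mat_def mat_def sum_2 forall_2 star_star star_zero star_one)

text \<open>As \<open>x\<close> is a group-like unitary, \<open>x_mat x\<close> is a biunitary
  corepresentation matrix, and the general result applies. The adjoint in its first diagonal entry
  makes \<open>e_12\<close> go to \<open>e_12 \<otimes> x\<close>, and not to
  \<open>e_12 \<otimes> star x\<close>.\<close>

lemma matrix_coaction_x_mat:
  assumes "compact_quantum_group Q" "star x * x = 1" "x * star x = 1" "coprod Q x = ten Q x x"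
  shows "matrix_coaction (coprod Q) (ten Q) (ad_units (x_mat x))"
proof (rule matrix_coaction_ad_units)
  have t: "min_tensor (ten Q)" and D: "star_hom (coprod Q)"
    using assms by (simp_all add: compact_quantum_group_def)
  show "star_hom (coprod Q)" by (rule D)
  have "coprod Q (star x) = ten Q (star x) (star x)"
    using D assms(4) by (simp add: star_hom_def min_tensorD[OF t])
  moreover have "coprod Q 1 = 1" using D by (simp add: star_hom_def)
  ultimately show "coprod Q (x_mat x $ j $ k) = (\<Sum>l\<in>UNIV. ten Q (x_mat x $ j $ l) (x_mat x $ l $ k))" for j k
    using exhaust_2[of j] exhaust_2[of k]
    by (auto simp: x_mat_def diag_mat_def sum_2 min_tensorD[OF t] min_tensor_zero[OF t] star_hom_zero[OF D])
  show "biunitary (x_mat x)" by (rule biunitary_x_mat) fact+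
qed (use assms in \<open>simp_all add: compact_quantum_group_def min_tensorD\<close>)

section \<open>The adjoint coaction on \<open>B_F\<close>\<close>

lemma Ad_nth_T:
  assumes "map_matrix \<phi> (qiso_corep g) = U" "star_hom \<phi>"
  shows "Ad U (bf_op (l, l', q, m)) $ (1, up k, 2, d) $ (1, up k', 2, d) =
    lin_mat (ad_units (T_mat (\<phi> \<circ> g) d)) m $ k $ k'"
proof -
  have "U $ (1, up j, 2, d) $ p = (\<Sum>i\<in>UNIV. if p = (1, up i, 2, d) then star (\<phi> (g (gen_T d j i))) else 0)" for j p
    unfolding assms(1)[symmetric] map_matrix_nth qiso_corep_row_T2 star_hom_sum[OF assms(2)]
    by (intro sum.cong refl) (use assms(2) in \<open>auto simp: star_hom_zero, auto simp: star_hom_def\<close>)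
  from Ad_nth[OF this this] show ?thesis
    by (simp add: bf_op_nth star_star lin_mat_def ad_units_def T_mat_def del: bf_op.simps)
qed

lemma Ad_nth_single:
  assumes "\<And>q. W $ p $ q = (if q = r then c else 0)" "\<And>q. W $ p' $ q = (if q = r' then c' else 0)"
  shows "Ad W L $ p $ p' = scaleC (L $ r $ r') (c * star c')"
  \<comment> \<open>The one-element index type \<open>unit\<close> turns each support sum into a
    single term.\<close>
  by (subst Ad_nth[where f = "\<lambda>_::unit. r" and f' = "\<lambda>_::unit. r'" and c = "\<lambda>_. c" and c' = "\<lambda>_. c'"])
     (simp_all add: assms UNIV_unit)

text \<open>Since the image is known to lie in the range of \<open>bf_op\<close>, four kinds of
  entries at one index \<open>d\<close> determine all its components. The index is
  arbitrary.\<close>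

lemma Ad_bf_op:
  assumes U: "map_matrix \<phi> (qiso_corep g) = U" and \<phi>: "star_hom \<phi>"
    and rel: "universal_cstar_algebra (qiso_relations Y free_gen) g"
    and range: "\<And>b. Ad U (bf_op b) \<in> range bf_op"
  shows "Ad U (bf_op (l, l', q, m)) = bf_op (scaleC l 1, scaleC l' 1,
    lin_mat (ad_units (x_mat (\<phi> (g gen_x0)))) q, lin_mat (ad_units (T_mat (\<phi> \<circ> g) d)) m)"
proof -
  note [simp del] = bf_op.simps
  note R = qiso_relations_image[OF rel \<phi>]
  \<comment> \<open>The unitarity relations with a trailing factor, as they occur once products are
    associated to the right.\<close>
  have R': "star (\<phi> (g (gen_x d))) * (\<phi> (g (gen_x d)) * z) = z" "\<phi> (g (gen_x d)) * (star (\<phi> (g (gen_x d))) * z) = z" for z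
    by (simp_all add: R flip: mult.assoc)
  obtain k k' p n where eq: "Ad U (bf_op (l, l', q, m)) = bf_op (k, k', p, n)"
    using range[of "(l, l', q, m)"] by (metis rangeE surj_pair)
  have phi: "\<phi> (star x) = star (\<phi> x)" "\<phi> (x * y) = \<phi> x * \<phi> y" "\<phi> (if b then x else 0) = (if b then \<phi> x else 0)" for x y b
    using \<phi> by (simp_all add: star_hom_zero) (simp_all add: star_hom_def)
  have n: "n $ i $ j = lin_mat (ad_units (T_mat (\<phi> \<circ> g) d)) m $ i $ j" for i j
    using Ad_nth_T[OF U \<phi>, of l l' q m i d j] by (simp add: eq bf_op_nth)
  have rows: "U $ (2, 1, 2, d) $ r = (if r = (2, 1, 2, d) then star (\<phi> (g (gen_x d))) else 0)"
    "U $ (2, 1, 4, d) $ r = (if r = (2, 1, 4, d) then \<phi> (g (gen_x d)) else 0)"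
    "U $ (1, 1, 1, d) $ r = (if r = (1, 1, 1, d) then \<phi> (g gen_x0) * \<phi> (g (gen_x d)) else 0)"
    "U $ (2, 1, 1, d) $ r = (if r = (2, 1, 1, d) then \<phi> (g (gen_x d)) else 0)" for r
    by (simp_all add: U[symmetric] map_matrix_nth qiso_corep_row_x phi)
  have "k = scaleC l 1" "k' = scaleC l' 1"
    using Ad_nth_single[OF rows(1,1), of "bf_op (l, l', q, m)"] Ad_nth_single[OF rows(2,2), of "bf_op (l, l', q, m)"]
    by (simp_all add: eq bf_op_nth R star_star)
  \<comment> \<open>The factors \<open>x_d\<close> of the two rows cancel, and \<open>x_0\<close>
    survives only off the diagonal of \<open>q\<close>.\<close>
  moreover have "p $ i $ j = lin_mat (ad_units (x_mat (\<phi> (g gen_x0)))) q $ i $ j" for i j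
    using exhaust_2[of i] exhaust_2[of j]
      Ad_nth_single[OF rows(3,3), of "bf_op (l, l', q, m)"] Ad_nth_single[OF rows(3,4), of "bf_op (l, l', q, m)"]
      Ad_nth_single[OF rows(4,3), of "bf_op (l, l', q, m)"] Ad_nth_single[OF rows(4,4), of "bf_op (l, l', q, m)"]
    by (auto simp: eq bf_op_nth lin_mat_def ad_units_def x_mat_def diag_mat_def sum_2 star_mult star_star star_one star_zero
      scaleC_zero_right R R' mult.assoc)
  ultimately show ?thesis
    using n by (simp add: eq) (metis vec_eq_iff)
qed

section \<open>Compatibility with \<open>\<sigma>\<close>\<close>

lemma lin_mat_x_mat:
  assumes "star x * x = 1" "x * star x = 1"
  shows "lin_mat (ad_units (x_mat x)) q $ 1 $ 1 = scaleC (q $ 1 $ 1) 1"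
    "lin_mat (ad_units (x_mat x)) q $ 1 $ 2 = scaleC (q $ 1 $ 2) x"
    "lin_mat (ad_units (x_mat x)) q $ 2 $ 1 = scaleC (q $ 2 $ 1) (star x)"
    "lin_mat (ad_units (x_mat x)) q $ 2 $ 2 = scaleC (q $ 2 $ 2) 1"
  using assms by (simp_all add: lin_mat_def ad_units_def x_mat_def diag_mat_def sum_2 star_star
    star_one star_zero scaleC_zero_right)

lemma sigma2_conj:
  fixes A :: "'a::star_algebra^2^2"
  shows "(lift_mat sigma2 ** A ** lift_mat sigma2) $ 1 $ 1 = A $ 2 $ 2"
    "(lift_mat sigma2 ** A ** lift_mat sigma2) $ 1 $ 2 = scaleC (- 1) (A $ 2 $ 1)"
    "(lift_mat sigma2 ** A ** lift_mat sigma2) $ 2 $ 1 = scaleC (- 1) (A $ 1 $ 2)"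
    "(lift_mat sigma2 ** A ** lift_mat sigma2) $ 2 $ 2 = A $ 1 $ 1"
  by (simp_all add: matrix_matrix_mult_def lift_mat_def map_matrix_nth sigma2_def sum_2
    scaleC_zero_left mult_scaleC_left mult_scaleC_right scaleC_scaleC scaleC_one)

text \<open>On the two copies of \<open>M_3\<close> the map exchanges \<open>F\<close> with its
  conjugate. On \<open>M_2\<close>, conjugation by \<open>sigma2\<close> swaps the off-diagonal
  positions while \<open>bar\<close> swaps \<open>x\<close> with \<open>star x\<close>, so each
  stays in its place.\<close>

lemma afc_sigma_afc_lin:
  assumes "star x * x = 1" "x * star x = 1"
  shows "afc_sigma (afc_lin (ad_units (x_mat x)) F (\<lambda>i j. bar (F i j)) a) =
    afc_lin (ad_units (x_mat x)) F (\<lambda>i j. bar (F i j)) (afc_sigma a)"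
proof -
  obtain l l' q m m' where a: "a = (l, l', q, m, m')" by (cases a)
  have bb: "bar (bar y) = y" for y :: "'a^3^3"
    by (simp add: bar_def vec_eq_iff map_matrix_nth star_star)
  have "lift_mat sigma2 ** bar (lin_mat (ad_units (x_mat x)) q) ** lift_mat sigma2 =
    lin_mat (ad_units (x_mat x)) (lift_mat sigma2 ** bar q ** lift_mat sigma2)"
    by (simp add: vec_eq_iff forall_2 lin_mat_x_mat[OF assms] sigma2_conj bar_def map_matrix_nth
      star_scaleC star_star star_one scaleC_scaleC star_complex_def scaleC_complex_def)
  then show ?thesis
    by (simp add: a afc_sigma_def afc_lin_def lin_mat_bar bb star_scaleC star_one star_complex_def)
qed

section \<open>Half-commutation as the criterion for a real extension\<close>

theorem theorem5p3:
  fixes Y :: "'n::finite yukawa"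
    and P :: "('p::cstar_algebra, 'pp::cstar_algebra, 'ppp::cstar_algebra) cqg"
    and g :: "'n qiso_gen \<Rightarrow> 'p"
    and Q :: "('q::cstar_algebra, 'qq::cstar_algebra, 'qqq::cstar_algebra) cqg"
    and U :: "'q^('n hf)^('n hf)"
    and \<phi> :: "'p \<Rightarrow> 'q"
  assumes "CARD('n) \<ge> 3"
    and "yukawa_assumptions Y"
    and "is_QISO Y P g"
    and "CJ_object Y Q U"
    and "CJ_morphism P (qiso_corep g) Q U \<phi>"
  shows "CJR_object Y Q U \<longleftrightarrow>
    (\<forall>m j j' j'' k k' k''.
       \<phi> (g (gen_T m j k)) * star (\<phi> (g (gen_T m j' k'))) * \<phi> (g (gen_T m j'' k'')) =
       \<phi> (g (gen_T m j'' k'')) * star (\<phi> (g (gen_T m j' k'))) * \<phi> (g (gen_T m j k)))"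
proof -
  define T where "T = T_mat (\<phi> \<circ> g)"
  define x where "x = \<phi> (g gen_x0)"
  have T_nth: "\<phi> (g (gen_T m j k)) = T m $ j $ k" for m j k
    by (simp add: T_def T_mat_def)
  have \<phi>: "star_hom \<phi>" and mor: "cqg_morphism P Q \<phi>" and U: "map_matrix \<phi> (qiso_corep g) = U"
    using assms(5) by (simp_all add: CJ_morphism_def cqg_morphism_def)
  have rel: "universal_cstar_algebra (qiso_relations Y free_gen) g"
    using assms(3) by (simp add: is_QISO_def)
  have Q: "compact_quantum_group Q" and range: "\<And>b. Ad U (bf_op b) \<in> range bf_op"
    using assms(4) unfolding CJ_object_def by blast+
  have biT: "biunitary (T m)" for m
    unfolding T_def by (rule qiso_relations_image[OF rel \<phi>])
  have x: "star x * x = 1" "x * star x = 1"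
    unfolding x_def by (rule qiso_relations_image[OF rel \<phi>])+
  show ?thesis
  proof
    assume "CJR_object Y Q U"
    then obtain \<alpha> where \<alpha>: "afc_coaction Q \<alpha>" "extends_Ad U \<alpha>" "\<And>a. afc_sigma (\<alpha> a) = \<alpha> (afc_sigma a)"
      by (auto simp: CJR_object_def)
    have mult: "\<alpha> (afc_mult a b) = afc_mult (\<alpha> a) (\<alpha> b)" for a b
      using \<alpha>(1) unfolding afc_coaction_def by blast
    \<comment> \<open>\<open>\<sigma>\<close> carries the fourth summand to the fifth, so the known
      values of \<open>\<alpha>\<close> on \<open>B_F\<close> determine the fifth component. This
      holds for every \<open>d\<close>, as the relations are wanted for each
      \<open>T_m\<close>.\<close>
    have last: "snd (snd (snd (snd (\<alpha> (0, 0, 0, 0, bar m))))) = bar (lin_mat (ad_units (T d)) m)" for m d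
    proof -
      obtain k k' p n where "Ad U (bf_op (0, 0, 0, m)) = bf_op (k, k', p, n)" "\<alpha> (0, 0, 0, m, 0) = (k, k', p, n, 0)"
        using \<alpha>(2) unfolding extends_Ad_def by blast
      note eq = this
      have n: "n = lin_mat (ad_units (T d)) m"
        using Ad_nth_T[OF U \<phi>, of 0 0 0 m _ d] by (simp add: eq(1) bf_op_nth T_def vec_eq_iff del: bf_op.simps)
      have "(0, 0, 0, 0, bar m) = afc_sigma (0, 0, 0, m, 0)"
        by (simp add: afc_sigma_def bar_def vec_eq_iff matrix_matrix_mult_def map_matrix_nth star_zero)
      then have "\<alpha> (0, 0, 0, 0, bar m) = afc_sigma (k, k', p, n, 0)"
        by (simp only: \<alpha>(3)[symmetric] eq(2))
      then show ?thesis
        by (simp add: afc_sigma_def n)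
    qed
    \<comment> \<open>Entrywise conjugation of complex matrices is multiplicative, so
      multiplicativity of \<open>\<alpha>\<close> on elements \<open>bar a\<close>,
      \<open>bar b\<close> of the fifth summand transfers to this map.\<close>
    have hom: "bar (lin_mat (ad_units (T d)) a) ** bar (lin_mat (ad_units (T d)) b) =
       bar (lin_mat (ad_units (T d)) (a ** b))" for a b d
    proof -
      have "bar (a ** b) = bar a ** bar b"
        by (simp add: vec_eq_iff bar_def map_matrix_nth matrix_matrix_mult_def star_complex_def)
      then have "(0, 0, 0, 0, bar (a ** b)) = afc_mult (0, 0, 0, 0, bar a) (0, 0, 0, 0, bar b)"
        by (simp add: afc_mult_def matrix_mult_zero_left)
      then have "\<alpha> (0, 0, 0, 0, bar (a ** b)) = afc_mult (\<alpha> (0, 0, 0, 0, bar a)) (\<alpha> (0, 0, 0, 0, bar b))"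
        by (simp only: mult)
      moreover have "snd (snd (snd (snd (afc_mult u v)))) = snd (snd (snd (snd u))) ** snd (snd (snd (snd v)))"
        for u v :: "'q afc"
        by (simp add: afc_mult_def split_beta)
      ultimately show ?thesis
        by (simp only: last[symmetric])
    qed
    have "bar (ad_units (T d) i j) ** bar (ad_units (T d) i' j') =
        bar (lin_mat (ad_units (T d)) (unit_mat i j ** unit_mat i' j'))" for d i j i' j'
      using hom[of d "unit_mat i j" "unit_mat i' j'"] by (simp only: lin_mat_unit)
    moreover have "unit_mat i j ** unit_mat i' j' = (if j = i' then unit_mat i j' else (0 :: complex^3^3))" for i j i' j'
      by (auto simp: unit_mat_def vec_eq_iff matrix_matrix_mult_def if_distrib[of "\<lambda>x. x * _"] cong: if_cong)
    ultimately have "bar (ad_units (T d) i j) ** bar (ad_units (T d) i' j') =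
        (if j = i' then bar (ad_units (T d) i j') else bar 0)" for d i j i' j'
      by (auto simp: lin_mat_unit lin_mat_zero)
    then have half: "(\<Sum>s\<in>UNIV. star (T d $ s $ j) * T d $ k $ i * (star (T d $ l $ j') * T d $ s $ i')) =
      (if j = i' then star (T d $ l $ j') * T d $ k $ i else 0)" for d i j i' j' k l
      by (simp add: vec_eq_iff matrix_matrix_mult_def bar_def map_matrix_nth ad_units_def star_mult
        star_star star_zero split: if_splits)
    have "T m $ j $ k * star (T m $ j' $ k') * T m $ j'' $ k'' = T m $ j'' $ k'' * star (T m $ j' $ k') * T m $ j $ k"
      for m j j' j'' k k' k''
    proof -
      \<comment> \<open>A Kronecker delta is inserted in order to be replaced through
        \<open>half\<close>. Orthogonality of the rows of \<open>T m\<close> then leaves only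
        \<open>s = j''\<close>, with the outer factors interchanged.\<close>
      have "T m $ j'' $ k'' * star (T m $ j' $ k') * T m $ j $ k =
        (\<Sum>i\<in>UNIV. T m $ j'' $ i * (if i = k'' then star (T m $ j' $ k') * T m $ j $ k else 0))"
        by (simp add: if_distrib[of "\<lambda>x. _ * x"] mult.assoc cong: if_cong)
      also have "\<dots> = (\<Sum>i\<in>UNIV. T m $ j'' $ i * (\<Sum>s\<in>UNIV. star (T m $ s $ i) * T m $ j $ k * (star (T m $ j' $ k') * T m $ s $ k'')))"
        by (simp add: half)
      also have "\<dots> = (\<Sum>s\<in>UNIV. (\<Sum>i\<in>UNIV. T m $ j'' $ i * star (T m $ s $ i)) * T m $ j $ k * star (T m $ j' $ k') * T m $ s $ k'')"
        unfolding sum_distrib_left sum_distrib_right mult.assoc by (rule sum.swap)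
      also have "\<dots> = T m $ j $ k * star (T m $ j' $ k') * T m $ j'' $ k''"
        by (simp add: biunitary_entries[OF biT] if_distrib[of "\<lambda>x. x * _"] cong: if_cong)
      finally show ?thesis by simp
    qed
    then show "\<forall>m j j' j'' k k' k''.
       \<phi> (g (gen_T m j k)) * star (\<phi> (g (gen_T m j' k'))) * \<phi> (g (gen_T m j'' k'')) =
       \<phi> (g (gen_T m j'' k'')) * star (\<phi> (g (gen_T m j' k'))) * \<phi> (g (gen_T m j k))"
      by (simp add: T_nth)
  next
    assume half: "\<forall>m j j' j'' k k' k''.
       \<phi> (g (gen_T m j k)) * star (\<phi> (g (gen_T m j' k'))) * \<phi> (g (gen_T m j'' k'')) =
       \<phi> (g (gen_T m j'' k'')) * star (\<phi> (g (gen_T m j' k'))) * \<phi> (g (gen_T m j k))"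
    define d :: 'n where "d = undefined" \<comment> \<open>all the \<open>T_m\<close> induce the same coaction\<close>
    \<comment> \<open>The first four components come from the adjoint coaction;
      \<open>\<sigma>\<close> dictates the conjugate of the fourth as the fifth.\<close>
    let ?\<alpha> = "afc_lin (ad_units (x_mat x)) (ad_units (T d)) (\<lambda>i j. bar (ad_units (T d) i j))"
    have t: "min_tensor (ten Q)" and D: "star_hom (coprod Q)"
      using Q by (simp_all add: compact_quantum_group_def)
    have DT: "coprod Q (T d $ j $ k) = (\<Sum>l\<in>UNIV. ten Q (T d $ j $ l) (T d $ l $ k))" for j k
      using coprod_qiso_gen(2)[OF assms(3) mor] by (simp add: T_nth)
    have "afc_coaction Q ?\<alpha>"
    proof (rule afc_coaction_lin[OF Q])
      show "matrix_coaction (coprod Q) (ten Q) (ad_units (x_mat x))"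
        using coprod_qiso_gen(1)[OF assms(3) mor] by (intro matrix_coaction_x_mat[OF Q x]) (simp add: x_def)
      show "matrix_coaction (coprod Q) (ten Q) (ad_units (T d))"
        by (rule matrix_coaction_ad_units[OF biT D DT]) (simp_all add: min_tensorD[OF t])
      show "matrix_coaction (coprod Q) (ten Q) (\<lambda>i j. bar (ad_units (T d) i j))"
        using half by (intro matrix_coaction_bar_ad_units[OF biT D DT]) (simp_all add: min_tensorD[OF t] T_nth)
    qed
    moreover have "extends_Ad U ?\<alpha>"
      unfolding extends_Ad_def Ad_bf_op[OF U \<phi> rel range, of _ _ _ _ d]
      by (auto simp: afc_lin_def lin_mat_zero T_def x_def simp del: bf_op.simps)
    moreover have "afc_sigma (?\<alpha> a) = ?\<alpha> (afc_sigma a)" for a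
      by (rule afc_sigma_afc_lin[OF x])
    ultimately show "CJR_object Y Q U"
      using assms(4) unfolding CJR_object_def by blast
  qed
qed

end
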